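(* Suppose that $n\geq 3$ is an odd integer and let $V$ be a vector space of dimension $n$ over $\mathbb{F}_q$. Let $\mathcal{M}$ be an $\mathbb{F}_q$-subspace of $\mathrm{Symm}(V)$ of dimension $2n$ in which each non-zero element has rank at least $n-2$. Then \[ A_{n-1}=q^{n-1}(q^n-1),\qquad A_{n-2}=\frac{(q^n-1)(q^{n-1}-1)}{q^2-1}. \] Furthermore, there is a one-to-one correspondence between one-dimensional subspaces of $\mathcal{M}$ spanned by elements of rank $n-2$ and two-dimensional subspaces of $V$, defined by associating a one-dimensional subspace of $\mathcal{M}$ spanned by a form of rank $n-2$ with the radical of that form. Each subspace $\mathcal{M}_u$ ($u\in V$ non-zero) is $n$-dimensional, and if $v$ is linearly independent of $u$ in $V$, then $\mathcal{M}_u\cap\mathcal{M}_v$ is one-dimensional and is the subspace of $\mathcal{M}$ corresponding (under the correspondence above) to the two-dimensional subspace of $V$ spanned by $u$ and $v$.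
   Context: $q$ is a power of a prime and $\mathbb{F}_q$ is the field of order $q$. $\mathrm{Symm}(V)$ denotes the $\mathbb{F}_q$-vector space of all symmetric bilinear forms $f:V\times V\to\mathbb{F}_q$. The radical of $f$ is $\mathrm{rad} f=\{u\in V: f(u,v)=0\text{ for all }v\in V\}$ and $\mathrm{rank} f=\dim V-\dim\mathrm{rad} f$. $A_k$ denotes the number of elements of rank $k$ in $\mathcal{M}$. For $u\in V$, $\mathcal{M}_u=\{f\in\mathcal{M}: u\in\mathrm{rad} f\}$. *)

theory Defs
  imports Complex_Main "HOL-Library.Function_Algebras"
begin

text \<open>Forms are functions \<open>'v \<Rightarrow> 'v \<Rightarrow> 'a\<close>; their addition is the pointwise one of
  \<open>Function_Algebras\<close>, and scalars act pointwise by \<open>form_scale\<close>.\<close>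

definition form_scale :: "'a::field \<Rightarrow> ('v \<Rightarrow> 'v \<Rightarrow> 'a) \<Rightarrow> ('v \<Rightarrow> 'v \<Rightarrow> 'a)" where
  "form_scale c f = (\<lambda>u v. c * f u v)"

lemma vector_space_form_scale: "vector_space form_scale"
  by unfold_locales (auto simp: form_scale_def fun_eq_iff algebra_simps)

definition symm_forms ::
  "('a::field \<Rightarrow> 'v::ab_group_add \<Rightarrow> 'v) \<Rightarrow> ('v \<Rightarrow> 'v \<Rightarrow> 'a) set" where
  "symm_forms scale =
     {f. (\<forall>u. Vector_Spaces.linear scale (*) (\<lambda>v. f u v)) \<and>
         (\<forall>v. Vector_Spaces.linear scale (*) (\<lambda>u. f u v)) \<and>
         (\<forall>u v. f u v = f v u)}"

definition form_rad :: "('v \<Rightarrow> 'v \<Rightarrow> 'a::zero) \<Rightarrow> 'v set" where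
  "form_rad f = {u. \<forall>v. f u v = 0}"

definition form_rank ::
  "('a::field \<Rightarrow> 'v::ab_group_add \<Rightarrow> 'v) \<Rightarrow> ('v \<Rightarrow> 'v \<Rightarrow> 'a) \<Rightarrow> nat" where
  "form_rank scale f = vector_space.dim scale UNIV - vector_space.dim scale (form_rad f)"

definition num_rank ::
  "('a::field \<Rightarrow> 'v::ab_group_add \<Rightarrow> 'v) \<Rightarrow> ('v \<Rightarrow> 'v \<Rightarrow> 'a) set \<Rightarrow> nat \<Rightarrow> nat" where
  "num_rank scale M k = card {f \<in> M. form_rank scale f = k}"

definition forms_killing :: "('v \<Rightarrow> 'v \<Rightarrow> 'a::zero) set \<Rightarrow> 'v \<Rightarrow> ('v \<Rightarrow> 'v \<Rightarrow> 'a) set" where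
  "forms_killing M u = {f \<in> M. u \<in> form_rad f}"

definition subspaces_of_dim ::
  "('a::field \<Rightarrow> 'w::ab_group_add \<Rightarrow> 'w) \<Rightarrow> nat \<Rightarrow> 'w set set" where
  "subspaces_of_dim scale k = {W. module.subspace scale W \<and> vector_space.dim scale W = k}"

definition rank_lines ::
  "('a::field \<Rightarrow> 'v::ab_group_add \<Rightarrow> 'v) \<Rightarrow> ('v \<Rightarrow> 'v \<Rightarrow> 'a) set \<Rightarrow> nat
     \<Rightarrow> ('v \<Rightarrow> 'v \<Rightarrow> 'a) set set" where
  "rank_lines scale M k =
     {L \<in> subspaces_of_dim form_scale 1. L \<subseteq> M \<and>
        (\<exists>f\<in>M. form_rank scale f = k \<and> L = module.span form_scale {f})}"

end

theory Submission
  imports Defs "HOL-Library.Cardinality"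
begin

text \<open>
Everything is a double count of zeros. Write \<open>q\<close> for the size of the field, \<open>B = q ^ n\<close> for the
size of \<open>V\<close>, and \<open>R f\<close> for the size of the radical of a form \<open>f\<close>. For a subspace \<open>N\<close> of symmetric
forms let \<open>h\<close> be the number of pairs \<open>(x, y)\<close> with \<open>f x y = 0\<close> for all \<open>f \<in> N\<close>. For a fixed pair,
\<open>f x y\<close> is linear in \<open>f\<close>, and for a fixed \<open>f\<close> the zeros of \<open>f\<close> can be counted, which gives
\<open>|N| * h = B * (\<Sum>f\<in>N. R f)\<close>.

This identity does not see the parity of the ranks. The parity enters through the quadratic
extension of the field: with \<open>\<omega>\<close> generating it, \<open>f\<close> extends to a Hermitian form, whose value at
\<open>x + \<omega> y\<close> is \<open>f x x + f x y + d * f y y\<close> for a suitable \<open>d\<close>. Its number of zeros depends only on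
the rank \<open>k\<close> of \<open>f\<close>, with sign \<open>(-1) ^ k\<close> (\<open>card_hermitian_zeros\<close>), in every characteristic.
Hence, if \<open>e\<close> counts the pairs that are Hermitian-isotropic for all of \<open>N\<close>,
\<open>|N| * e = B * (\<Sum>f\<in>N. (-1) ^ rank f * R f)\<close>.

Now let \<open>N\<close> consist of the forms in \<open>M\<close> with a given \<open>u \<noteq> 0\<close> in the radical. Its non-zero members
have even rank \<open>n - 1\<close> with \<open>R f = q\<close>, or odd rank \<open>n - 2\<close> with \<open>R f = q\<^sup>2\<close>. The combination
\<open>(q + 1) * R f + (q - 1) * (-1) ^ rank f * R f\<close> is equal to \<open>2 * q\<^sup>2\<close> in both cases, so
\<open>(q + 1) * h + (q - 1) * e\<close> is determined by \<open>|N|\<close>. The pairs with an entry in \<open>span {u}\<close> give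
lower bounds for \<open>h\<close> and \<open>e\<close>, and these force \<open>|N| \<le> B\<close> (\<open>killed_by_extremal\<close>). Since \<open>f \<mapsto> f u\<close>
maps the \<open>2 * n\<close>-dimensional \<open>M\<close> to the dual of \<open>V\<close>, also \<open>|N| \<ge> B\<close>. So equality holds
everywhere. Equality for \<open>h\<close> says that for \<open>v\<close> outside \<open>span {u}\<close> only the vectors of \<open>span {u}\<close>
are orthogonal to \<open>v\<close> under all of \<open>N\<close>, and therefore exactly \<open>q\<close> members of \<open>N\<close> have \<open>v\<close> in
their radical too.

Thus each plane of \<open>V\<close> is the radical of the members of exactly one line of \<open>M\<close>, and counting the
incidences of non-zero forms with vectors, and with independent pairs of vectors, in their radicals
gives the two rank counts.
\<close>

section \<open>The norm form of a quadratic extension\<close>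

text \<open>The norm of \<open>a + b * \<omega>\<close>, where \<open>\<omega>\<^sup>2 - \<omega> + d = 0\<close>. Keeping the trace of \<open>\<omega>\<close> equal to \<open>1\<close>
  treats odd and even characteristic alike.\<close>

definition norm_form :: "'a::field \<Rightarrow> 'a \<Rightarrow> 'a \<Rightarrow> 'a" where
  "norm_form d a b = a * a + a * b + d * b * b"

text \<open>The map \<open>x \<mapsto> x\<^sup>2 + x\<close> takes the value \<open>0\<close> at both \<open>0\<close> and \<open>-1\<close>, so on a finite field it misses
  some value.\<close>

lemma irreducible_quadratic_exists:
  "\<exists>d::'a::{field,finite}. \<forall>x. x * x + x + d \<noteq> 0"
proof -
  let ?g = "\<lambda>x::'a. x * x + x"
  have "?g 0 = ?g (-1)" "(0::'a) \<noteq> -1" by simp_all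
  hence "\<not> inj ?g" unfolding inj_def by blast
  hence "\<not> surj ?g" using finite_UNIV_surj_inj[of ?g] by auto
  then obtain e where e: "\<And>x. e \<noteq> ?g x" unfolding surj_def by blast
  have "x * x + x + (- e) \<noteq> 0" for x using e[of x] by simp
  thus ?thesis by blast
qed

lemma card_UNIV_field_ge2: "CARD('a::{field,finite}) \<ge> 2"
proof -
  have "card {0, 1::'a} \<le> CARD('a)" by (rule card_mono) auto
  thus ?thesis by simp
qed

lemma card_field_less_square: "CARD('a::{field,finite}) < CARD('a) ^ 2"
  using card_UNIV_field_ge2[where ?'a = 'a] by (simp add: power2_eq_square)

text \<open>Multiplicativity of the norm, with the product
  \<open>(a + b * \<omega>) * (a' + b' * \<omega>)\<close> written in coordinates.\<close>

lemma norm_form_mult: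
  "norm_form d (a * a' - d * b * b') (a * b' + a' * b + b * b') =
     norm_form d a b * norm_form d a' b'"
  by (simp add: norm_form_def algebra_simps)

lemma norm_form_scale: "norm_form d (c * a) (c * b) = c * c * norm_form d a b"
  by (simp add: norm_form_def algebra_simps)

lemma norm_form_eq_0_iff:
  assumes "\<forall>x. x * x + x + d \<noteq> 0"
  shows "norm_form d a b = 0 \<longleftrightarrow> a = 0 \<and> b = 0"
proof
  assume z: "norm_form d a b = 0"
  have "b = 0"
  proof (rule ccontr)
    assume "b \<noteq> 0"
    hence "(a / b) * (a / b) + a / b + d = norm_form d a b / (b * b)"
      by (simp add: norm_form_def field_simps)
    with z assms show False by (metis div_0)
  qed
  with z show "a = 0 \<and> b = 0" by (simp add: norm_form_def)
qed (simp add: norm_form_def)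

lemma card_monic_quadratic_roots_le:
  fixes b k :: "'a::{field,finite}"
  shows "card {a. a * a + a * b = k} \<le> 2"
proof (cases "{a. a * a + a * b = k} = {}")
  case False
  then obtain r where r: "r * r + r * b = k" by blast
  have "a = r \<or> a = - r - b" if "a * a + a * b = k" for a
  proof -
    have "(a - r) * (a + r + b) = 0" using that r by (simp add: algebra_simps)
    thus ?thesis
      by (metis add_uminus_conv_diff eq_iff_diff_eq_0 minus_add_distrib mult_eq_0_iff
          add.assoc eq_neg_iff_add_eq_0)
  qed
  hence "{a. a * a + a * b = k} \<subseteq> {r, - r - b}" by blast
  hence "card {a. a * a + a * b = k} \<le> card {r, - r - b}" by (intro card_mono) auto
  also have "\<dots> \<le> 2" by (simp add: card_insert_if)
  finally show ?thesis .
qed simp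

text \<open>Multiplication by an element of norm \<open>g\<close> is a bijection, so all represented non-zero values have
  equally many representations. If some non-zero value were not represented, the represented
  ones would be disjoint from a coset of the same size, hence at most \<open>(q - 1) / 2\<close> many, and each would have at least
  \<open>2 * (q + 1)\<close> representations. But for each \<open>b\<close> there are at most two \<open>a\<close>, so the number is at most
  \<open>2 * q\<close>. Hence the \<open>q\<^sup>2 - 1\<close> non-zero pairs are spread evenly over \<open>q - 1\<close> values.\<close>

lemma card_norm_form_fiber:
  fixes d e :: "'a::{field,finite}"
  assumes d: "\<forall>x. x * x + x + d \<noteq> 0" and e: "e \<noteq> 0"
  shows "card {(a, b). norm_form d a b = e} = CARD('a) + 1"
proof -
  define \<rho> where "\<rho> c = card {p. norm_form d (fst p) (snd p) = c}" for c
  define G where "G = {c. c \<noteq> 0 \<and> (\<exists>a b. norm_form d a b = c)}"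
  have le: "\<rho> c \<le> \<rho> (g * c)" if g: "g \<in> G" for c g
  proof -
    from g obtain a b where ab: "norm_form d a b = g" "g \<noteq> 0" by (auto simp: G_def)
    define T where "T p = (a * fst p - d * b * snd p, a * snd p + fst p * b + b * snd p)" for p
    have T: "norm_form d (fst (T p)) (snd (T p)) = g * norm_form d (fst p) (snd p)" for p
      using norm_form_mult[of d a "fst p" b "snd p"] ab by (simp add: T_def)
    have "inj T"
    proof (rule injI)
      fix p p' assume eq: "T p = T p'"
      let ?r = "(fst p - fst p', snd p - snd p')"
      have "T ?r = (0, 0)" using eq by (auto simp: T_def algebra_simps)
      hence "g * norm_form d (fst ?r) (snd ?r) = 0"
        using T[of ?r] by (simp add: norm_form_def)
      hence "fst p = fst p' \<and> snd p = snd p'"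
        using ab norm_form_eq_0_iff[OF d] by simp
      thus "p = p'" by (simp add: prod_eq_iff)
    qed
    moreover have "T ` {p. norm_form d (fst p) (snd p) = c} \<subseteq>
        {p. norm_form d (fst p) (snd p) = g * c}" using T by auto
    ultimately show ?thesis unfolding \<rho>_def
      by (metis (no_types, lifting) card_inj_on_le finite inj_on_subset subset_UNIV)
  qed
  have inverse_in_G: "inverse c \<in> G" if c: "c \<in> G" for c
  proof -
    from c obtain a b where ab: "norm_form d a b = c" "c \<noteq> 0" by (auto simp: G_def)
    have "norm_form d (inverse c * a) (inverse c * b) = inverse c"
      unfolding norm_form_scale using ab by simp
    thus ?thesis using ab by (auto simp: G_def)
  qed
  have \<rho>1: "\<rho> c = \<rho> 1" if c: "c \<in> G" for c
    using le[OF inverse_in_G[OF c], of c] le[OF c, of 1] c by (simp add: G_def)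
  have "(\<Sum>c\<in>UNIV. \<rho> c) = card (\<Union>c. {p. norm_form d (fst p) (snd p) = c})"
    unfolding \<rho>_def by (rule card_UN_disjoint[symmetric]) auto
  also have "(\<Union>c. {p. norm_form d (fst p) (snd p) = c}) = UNIV" by auto
  also have "card (UNIV :: ('a \<times> 'a) set) = CARD('a) * CARD('a)" by simp
  finally have total: "(\<Sum>c\<in>UNIV. \<rho> c) = CARD('a) * CARD('a)" .
  have "\<rho> 0 = card {(0, 0) :: 'a \<times> 'a}"
    unfolding \<rho>_def norm_form_eq_0_iff[OF d] by (rule arg_cong[of _ _ card]) auto
  hence \<rho>0: "\<rho> 0 = 1" by simp
  have "(\<Sum>c\<in>UNIV. \<rho> c) = \<rho> 0 + (\<Sum>c\<in>UNIV - {0}. \<rho> c)" by (simp add: sum.remove)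
  also have "(\<Sum>c\<in>UNIV - {0}. \<rho> c) = (\<Sum>c\<in>G. \<rho> c)"
    by (rule sum.mono_neutral_right) (auto simp: G_def \<rho>_def)
  also have "\<dots> = card G * \<rho> 1" using \<rho>1 by simp
  finally have eqG: "card G * \<rho> 1 + 1 = CARD('a) * CARD('a)" using total \<rho>0 by simp
  \<comment> \<open>For each \<open>b\<close> the equation is a monic quadratic in \<open>a\<close>.\<close>
  have \<rho>le: "\<rho> 1 \<le> 2 * CARD('a)"
  proof -
    have "{p. norm_form d (fst p) (snd p) = 1} =
        (\<Union>b\<in>UNIV. (\<lambda>a. (a, b)) ` {a. a * a + a * b = 1 - d * b * b})"
      by (auto simp: norm_form_def image_iff algebra_simps)
    hence "\<rho> 1 \<le> (\<Sum>b\<in>UNIV. card ((\<lambda>a. (a, b)) ` {a. a * a + a * b = 1 - d * b * b}))"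
      unfolding \<rho>_def by (simp add: card_UN_le)
    also have "\<dots> \<le> (\<Sum>b\<in>(UNIV::'a set). 2)"
      by (intro sum_mono order.trans[OF card_image_le card_monic_quadratic_roots_le]) simp
    finally show ?thesis by simp
  qed
  have full: "G = UNIV - {0}"
  proof (rule ccontr)
    assume "G \<noteq> UNIV - {0}"
    moreover have "G \<subseteq> UNIV - {0}" by (auto simp: G_def)
    ultimately obtain h where h: "h \<noteq> 0" "h \<notin> G" by blast
    \<comment> \<open>The coset of \<open>h\<close> is disjoint from the represented values and equally large.\<close>
    have "h * g \<notin> G" if g: "g \<in> G" for g
    proof
      assume "h * g \<in> G"
      then obtain a b where ab: "norm_form d a b = h * g" by (auto simp: G_def)
      have "inverse g * (h * g) = h" using g by (simp add: G_def)
      hence "\<rho> (h * g) \<le> \<rho> h" by (metis le[OF inverse_in_G[OF g]])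
      moreover have "\<rho> (h * g) \<noteq> 0" using ab by (auto simp: \<rho>_def)
      ultimately have "\<rho> h \<noteq> 0" by simp
      then obtain a b where "norm_form d a b = h" by (auto simp: \<rho>_def)
      with h show False by (auto simp: G_def)
    qed
    hence "(*) h ` G \<inter> G = {}" by blast
    hence "card ((*) h ` G \<union> G) = card ((*) h ` G) + card G" by (simp add: card_Un_disjoint)
    also have "card ((*) h ` G) = card G" by (rule card_image) (use h in \<open>auto intro: inj_onI\<close>)
    finally have "2 * card G = card ((*) h ` G \<union> G)" by simp
    also have "\<dots> \<le> card (UNIV - {0::'a})"
      by (rule card_mono) (use h in \<open>auto simp: G_def\<close>)
    finally have "2 * card G \<le> CARD('a) - 1" by (simp add: card_Diff_singleton)
    hence "2 * card G * \<rho> 1 \<le> (CARD('a) - 1) * (2 * CARD('a))" using \<rho>le by (rule mult_le_mono)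
    hence "2 * (CARD('a) * CARD('a)) \<le> (CARD('a) - 1) * (2 * CARD('a)) + 2" using eqG by linarith
    moreover have "(CARD('a) - 1) * (2 * CARD('a)) = 2 * (CARD('a) * CARD('a)) - 2 * CARD('a)" by (simp add: algebra_simps)
    moreover have "CARD('a) * CARD('a) \<ge> CARD('a)" by simp
    ultimately show False using card_UNIV_field_ge2[where ?'a = 'a] by linarith
  qed
  have "(CARD('a) - 1) * \<rho> 1 + 1 = CARD('a) * CARD('a)" using eqG full by (simp add: card_Diff_singleton)
  moreover obtain k where "CARD('a) = Suc (Suc k)"
    using card_UNIV_field_ge2[where ?'a = 'a] by (metis add_2_eq_Suc le_Suc_ex)
  ultimately have "(CARD('a) - 1) * \<rho> 1 = (CARD('a) - 1) * (CARD('a) + 1)" "CARD('a) - 1 > 0" by auto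
  hence "\<rho> 1 = CARD('a) + 1" using nat_mult_eq_cancel1 by blast
  moreover have "e \<in> G" using full e by simp
  ultimately have "\<rho> e = CARD('a) + 1" using \<rho>1 by simp
  moreover have "{(a, b). norm_form d a b = e} = {p. norm_form d (fst p) (snd p) = e}" by auto
  ultimately show ?thesis by (simp add: \<rho>_def)
qed

section \<open>Counting in vector spaces over a finite field\<close>

lemma sum_card_swap:
  assumes "finite A" "finite B"
  shows "(\<Sum>x\<in>A. real (card {y \<in> B. P x y})) = (\<Sum>y\<in>B. real (card {x \<in> A. P x y}))"
proof -
  have "(\<Sum>x\<in>A. real (card {y \<in> B. P x y})) = (\<Sum>x\<in>A. \<Sum>y\<in>B. if P x y then 1 else 0)"
    using assms by (simp add: sum.If_cases Int_def)
  also have "\<dots> = (\<Sum>y\<in>B. \<Sum>x\<in>A. if P x y then 1 else 0)" by (rule sum.swap)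
  also have "\<dots> = (\<Sum>y\<in>B. real (card {x \<in> A. P x y}))"
    using assms by (simp add: sum.If_cases Int_def)
  finally show ?thesis .
qed

lemma sum_if_const_card:
  assumes "finite A"
  shows "(\<Sum>x\<in>A. if P x then a else b) =
    real (card {x \<in> A. P x}) * (a - b) + real (card A) * (b :: real)"
proof -
  have "card A = card {x \<in> A. P x} + card {x \<in> A. \<not> P x}"
    using assms by (subst card_Un_disjoint[symmetric]) (auto intro: arg_cong[of _ _ card])
  moreover have "A \<inter> {x. P x} = {x \<in> A. P x}" "A \<inter> - {x. P x} = {x \<in> A. \<not> P x}" by auto
  ultimately show ?thesis using assms by (simp add: sum.If_cases algebra_simps)
qed

locale finite_field_space = vector_space scale
  for scale :: "'a::{field,finite} \<Rightarrow> 'b::ab_group_add \<Rightarrow> 'b"  (infixr "*s" 75)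
begin

lemma CARD_ge2: "real CARD('a) \<ge> 2"
  using card_UNIV_field_ge2[where ?'a = 'a] by linarith

lemma card_span_insert:
  assumes "finite (span B)" "b \<notin> span B"
  shows "card (span (insert b B)) = CARD('a) * card (span B)"
proof -
  let ?T = "\<lambda>(c, x). x + c *s b"
  have "inj_on ?T (UNIV \<times> span B)"
  proof (rule inj_onI, clarsimp)
    fix c c' x x'
    assume in_span: "x \<in> span B" "x' \<in> span B" and eq: "x + c *s b = x' + c' *s b"
    have "(c - c') *s b = x' - x" using eq by (simp add: scale_left_diff_distrib algebra_simps)
    hence "(c - c') *s b \<in> span B" using in_span by (simp add: span_diff)
    hence "inverse (c - c') *s ((c - c') *s b) \<in> span B" by (rule span_scale)
    hence "c = c'" using assms(2) by (cases "c = c'") auto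
    with eq show "c = c' \<and> x = x'" by simp
  qed
  moreover have "?T ` (UNIV \<times> span B) = span (insert b B)"
  proof -
    have "y \<in> ?T ` (UNIV \<times> span B)" if "y - k *s b \<in> span B" for y k
      by (rule image_eqI[of _ _ "(k, y - k *s b)"]) (use that in auto)
    moreover have "\<exists>k. (x + c *s b) - k *s b \<in> span B" if "x \<in> span B" for x c
      using that by (intro exI[of _ c]) simp
    ultimately show ?thesis by (auto simp: span_insert)
  qed
  ultimately have "card (span (insert b B)) = card ((UNIV :: 'a set) \<times> span B)"
    by (metis card_image)
  thus ?thesis by (simp add: card_cartesian_product)
qed

lemma finite_card_span_independent:
  assumes "finite B" "independent B"
  shows "finite (span B) \<and> card (span B) = CARD('a) ^ card B"
  using assms
proof (induction B rule: finite_induct)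
  case (insert b B)
  hence IH: "finite (span B)" "card (span B) = CARD('a) ^ card B"
    and b: "b \<notin> span B" by (auto simp: independent_insert)
  have "card (span (insert b B)) = CARD('a) ^ card (insert b B)"
    using card_span_insert[OF IH(1) b] IH(2) insert by simp
  moreover have "finite (span (insert b B))"
    using calculation by (metis card.infinite card_UNIV_field_ge2 not_numeral_le_zero power_not_zero)
  ultimately show ?case by simp
qed simp

lemma finite_subspace_if_dim_pos:
  assumes "subspace S" "dim S > 0"
  shows "finite S"
proof -
  obtain B where B: "B \<subseteq> S" "independent B" "S \<subseteq> span B" "card B = dim S"
    by (rule basis_exists)
  hence "finite B" using assms(2) by (metis card.infinite less_irrefl)
  with B finite_card_span_independent show ?thesis by (meson finite_subset)
qed

lemma card_subspace:
  assumes "subspace S" "finite S"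
  shows "real (card S) = real CARD('a) ^ dim S"
proof -
  obtain B where B: "B \<subseteq> S" "independent B" "S \<subseteq> span B" "card B = dim S"
    by (rule basis_exists)
  have "span B = S" using B assms by (intro subset_antisym span_minimal) auto
  moreover have "finite B" using B assms by (meson finite_subset)
  ultimately show ?thesis using finite_card_span_independent[OF _ B(2)] B(4) by simp
qed

lemma dim_eqI_card:
  assumes "subspace S" "finite S" "real (card S) = real CARD('a) ^ k"
  shows "dim S = k"
  using card_subspace[OF assms(1,2)] assms(3) CARD_ge2 by (simp add: power_inject_exp)

text \<open>A linear functional on a finite space vanishes on everything or on a hyperplane; both cases are
  stated as one equation so that it can be summed over families of functionals.\<close>

lemma card_kernel:
  assumes S: "subspace S" "finite S"
    and add: "\<And>x y. x \<in> S \<Longrightarrow> y \<in> S \<Longrightarrow> \<phi> (x + y) = \<phi> x + \<phi> y"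
    and hom: "\<And>c x. x \<in> S \<Longrightarrow> \<phi> (c *s x) = c * \<phi> x"
  shows "real CARD('a) * real (card {x \<in> S. \<phi> x = 0}) =
    real (card S) * (if \<forall>x\<in>S. \<phi> x = 0 then real CARD('a) else 1)"
proof (cases "\<forall>x\<in>S. \<phi> x = 0")
  case True
  hence "{x \<in> S. \<phi> x = 0} = S" by auto
  thus ?thesis using True by simp
next
  case False
  then obtain w where w: "w \<in> S" "\<phi> w \<noteq> 0" by blast
  let ?K = "{x \<in> S. \<phi> x = 0}"
  have sub: "subspace ?K"
    using S(1) hom[of 0 0] by (auto simp: subspace_def add hom)
  have span_K: "span ?K = ?K" using sub by (simp add: span_eq_iff)
  have "span (insert w ?K) = S"
  proof
    show "span (insert w ?K) \<subseteq> S" using S(1) w by (intro span_minimal) auto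
    show "S \<subseteq> span (insert w ?K)"
    proof
      fix x assume x: "x \<in> S"
      define c where "c = \<phi> x / \<phi> w"
      have cw: "(- c) *s w \<in> S" using S(1) w(1) by (rule subspace_scale)
      have "\<phi> ((- c) *s w) = - \<phi> x" unfolding hom[OF w(1)] using w by (simp add: c_def)
      hence "\<phi> (x + (- c) *s w) = 0" using add[OF x cw] by simp
      moreover have "x + (- c) *s w \<in> S" using S(1) x cw by (rule subspace_add)
      ultimately show "x \<in> span (insert w ?K)"
        unfolding span_insert span_K by (intro CollectI exI[of _ c]) simp
    qed
  qed
  moreover have "w \<notin> span ?K" unfolding span_K using w by simp
  ultimately have "card S = CARD('a) * card ?K"
    using card_span_insert[of ?K w] S(2) unfolding span_K by simp
  thus ?thesis by (subst if_not_P[OF False]) simp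
qed

text \<open>Double counting of the pairs \<open>(f, x)\<close> with \<open>B f x = 0\<close>: for fixed \<open>x\<close>, the condition holds
  on all of \<open>N\<close> or on a hyperplane of \<open>N\<close>.\<close>

lemma sum_card_zeros:
  fixes B :: "'b \<Rightarrow> 'c \<Rightarrow> 'a"
  assumes N: "subspace N" "finite N" and X: "finite X"
    and add: "\<And>f g x. f \<in> N \<Longrightarrow> g \<in> N \<Longrightarrow> B (f + g) x = B f x + B g x"
    and hom: "\<And>c f x. f \<in> N \<Longrightarrow> B (c *s f) x = c * B f x"
  shows "real CARD('a) * (\<Sum>f\<in>N. real (card {x \<in> X. B f x = 0})) =
    real (card N) * ((real CARD('a) - 1) * real (card {x \<in> X. \<forall>f\<in>N. B f x = 0}) + real (card X))"
proof -
  have "real CARD('a) * (\<Sum>f\<in>N. real (card {x \<in> X. B f x = 0})) =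
      (\<Sum>x\<in>X. real CARD('a) * real (card {f \<in> N. B f x = 0}))"
    by (simp add: sum_card_swap[OF N(2) X] sum_distrib_left)
  also have "\<dots> = (\<Sum>x\<in>X. real (card N) * (if \<forall>f\<in>N. B f x = 0 then real CARD('a) else 1))"
    by (intro sum.cong refl card_kernel N) (auto simp: add hom)
  also have "\<dots> = real (card N) * (\<Sum>x\<in>X. if \<forall>f\<in>N. B f x = 0 then real CARD('a) else 1)"
    by (simp add: sum_distrib_left)
  finally show ?thesis by (simp add: sum_if_const_card[OF X] mult.commute)
qed

end

interpretation forms: finite_field_space
  "form_scale :: 'a::{field,finite} \<Rightarrow> ('v \<Rightarrow> 'v \<Rightarrow> 'a) \<Rightarrow> _"
  by (intro finite_field_space.intro vector_space_form_scale)

section \<open>Symmetric bilinear forms\<close>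

text \<open>The value at \<open>x + \<omega> * y\<close> of the Hermitian extension of \<open>f\<close> to the quadratic extension field in
  which \<open>\<omega>\<close> has trace \<open>1\<close> and norm \<open>d\<close>.\<close>

definition hermitian_form ::
  "'a::field \<Rightarrow> ('v \<Rightarrow> 'v \<Rightarrow> 'a) \<Rightarrow> 'v \<Rightarrow> 'v \<Rightarrow> 'a" where
  "hermitian_form d f x y = f x x + f x y + d * f y y"

context finite_field_space
begin

lemma symm_formsI:
  assumes "\<And>x y z. f (x + y) z = f x z + f y z" "\<And>c x z. f (c *s x) z = c * f x z"
    "\<And>x y. f x y = f y x"
  shows "f \<in> symm_forms scale"
proof -
  have lin: "Vector_Spaces.linear scale (*) (\<lambda>u. f u v)" for v
    unfolding Vector_Spaces.linear_iff using assms(1,2) vector_space_axioms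
    by (auto simp: vector_space_def distrib_left distrib_right mult.assoc)
  have "(\<lambda>u. f u v) = (\<lambda>u. f v u)" for v using assms(3) by blast
  hence "Vector_Spaces.linear scale (*) (\<lambda>u. f v u)" for v using lin[of v] by metis
  with lin show ?thesis unfolding symm_forms_def using assms(3) by blast
qed

lemma symm_formsD:
  assumes "f \<in> symm_forms scale"
  shows "f (x + y) z = f x z + f y z" "f (c *s x) z = c * f x z"
    "f z (x + y) = f z x + f z y" "f z (c *s x) = c * f z x"
    "f 0 z = 0" "f z 0 = 0" "f (x - y) z = f x z - f y z" "f z (x - y) = f z x - f z y"
proof -
  have lin: "Vector_Spaces.linear scale (*) (\<lambda>v. f u v)" "Vector_Spaces.linear scale (*) (\<lambda>v. f v u)"
    for u using assms by (auto simp: symm_forms_def)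
  show add: "f (x + y) z = f x z + f y z" "f z (x + y) = f z x + f z y" for x y
    using lin[of z] unfolding Vector_Spaces.linear_iff by auto
  show hom: "f (c *s x) z = c * f x z" "f z (c *s x) = c * f z x" for c x
    using lin[of z] unfolding Vector_Spaces.linear_iff by auto
  show "f 0 z = 0" "f z 0 = 0" using hom[of 0 0] by auto
  show "f (x - y) z = f x z - f y z" "f z (x - y) = f z x - f z y"
    using add[of "x - y" y] by (auto simp: algebra_simps)
qed

lemma symm_forms_commute: "f \<in> symm_forms scale \<Longrightarrow> f x y = f y x"
  unfolding symm_forms_def by blast

lemma not_in_form_rad: "f x y \<noteq> 0 \<Longrightarrow> x \<notin> form_rad f"
  by (auto simp: form_rad_def)

lemma subspace_form_rad:
  assumes "f \<in> symm_forms scale"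
  shows "subspace (form_rad f)"
  by (simp add: subspace_def form_rad_def symm_formsD[OF assms])

lemma span_form_rad: "f \<in> symm_forms scale \<Longrightarrow> span (form_rad f) = form_rad f"
  by (rule iffD2[OF span_eq_iff subspace_form_rad])

text \<open>Gram-Schmidt carried out on the form instead of the space: the form is replaced by its pullback
  along the projection onto the orthogonal complement of \<open>u\<close> when \<open>f u u \<noteq> 0\<close>, respectively of the
  hyperbolic plane spanned by \<open>u\<close> and \<open>v\<close> when \<open>f\<close> is alternating with \<open>f u v = 1\<close>. The space stays the same and the radical grows, so the induction on
  the rank needs no subspaces.\<close>

definition deflate :: "('b \<Rightarrow> 'b \<Rightarrow> 'a) \<Rightarrow> 'b \<Rightarrow> 'b \<Rightarrow> 'b \<Rightarrow> 'a" where
  "deflate f u = (\<lambda>x y. f x y - f x u * f y u / f u u)"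

definition deflate_pair :: "('b \<Rightarrow> 'b \<Rightarrow> 'a) \<Rightarrow> 'b \<Rightarrow> 'b \<Rightarrow> 'b \<Rightarrow> 'b \<Rightarrow> 'a" where
  "deflate_pair f u v = (\<lambda>x y. f x y - f x v * f u y - f x u * f v y)"

lemma deflate_symm_forms:
  assumes "f \<in> symm_forms scale"
  shows "deflate f u \<in> symm_forms scale"
proof (intro symm_formsI)
  show "deflate f u x y = deflate f u y x" for x y
    using symm_forms_commute[OF assms, of x y] by (simp add: deflate_def mult.commute)
qed (simp_all add: deflate_def symm_formsD[OF assms] distrib_right add_divide_distrib
    right_diff_distrib mult.assoc)

lemma deflate_pair_symm_forms:
  assumes "f \<in> symm_forms scale"
  shows "deflate_pair f u v \<in> symm_forms scale"
proof (intro symm_formsI)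
  show "deflate_pair f u v x y = deflate_pair f u v y x" for x y
    using symm_forms_commute[OF assms, of x y] symm_forms_commute[OF assms, of u]
      symm_forms_commute[OF assms, of v] by (simp add: deflate_pair_def)
qed (simp_all add: deflate_pair_def symm_formsD[OF assms] algebra_simps)

lemma form_rad_deflate:
  assumes f: "f \<in> symm_forms scale" and u: "f u u \<noteq> 0"
  shows "form_rad (deflate f u) = span (insert u (form_rad f))"
proof -
  have "x \<in> form_rad (deflate f u) \<longleftrightarrow> (\<exists>k. x - k *s u \<in> form_rad f)" for x
  proof
    assume x: "x \<in> form_rad (deflate f u)"
    have "f (x - (f x u / f u u) *s u) y = 0" for y
    proof -
      have "f x y - f x u * f y u / f u u = 0" using x unfolding form_rad_def deflate_def by blast
      thus ?thesis by (simp add: symm_formsD[OF f] symm_forms_commute[OF f, of u y])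
    qed
    thus "\<exists>k. x - k *s u \<in> form_rad f" unfolding form_rad_def by blast
  next
    assume "\<exists>k. x - k *s u \<in> form_rad f"
    then obtain k where "x - k *s u \<in> form_rad f" ..
    hence k: "f x y = k * f u y" for y by (simp add: form_rad_def symm_formsD[OF f])
    have "deflate f u x y = 0" for y
      using u by (simp add: deflate_def k symm_forms_commute[OF f, of y u])
    thus "x \<in> form_rad (deflate f u)" by (simp add: form_rad_def)
  qed
  thus ?thesis unfolding span_insert span_form_rad[OF f] by blast
qed

lemma form_rad_deflate_pair:
  assumes f: "f \<in> symm_forms scale" and alt: "\<And>x. f x x = 0" and uv: "f u v = 1"
  shows "form_rad (deflate_pair f u v) = span (insert u (insert v (form_rad f)))"
proof -
  have vu: "f v u = 1" using uv symm_forms_commute[OF f, of u v] by simp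
  have "x \<in> form_rad (deflate_pair f u v) \<longleftrightarrow> (\<exists>k l. x - k *s u - l *s v \<in> form_rad f)" for x
  proof
    assume "x \<in> form_rad (deflate_pair f u v)"
    hence "x - f x v *s u - f x u *s v \<in> form_rad f"
      by (auto simp: form_rad_def deflate_pair_def symm_formsD[OF f])
    thus "\<exists>k l. x - k *s u - l *s v \<in> form_rad f" by blast
  next
    assume "\<exists>k l. x - k *s u - l *s v \<in> form_rad f"
    then obtain k l where "x - k *s u - l *s v \<in> form_rad f" by blast
    hence "f x y = k * f u y + l * f v y" for y
      by (simp add: form_rad_def symm_formsD[OF f] algebra_simps)
    thus "x \<in> form_rad (deflate_pair f u v)"
      using uv vu alt by (auto simp: form_rad_def deflate_pair_def)
  qed
  thus ?thesis unfolding span_insert span_form_rad[OF f] by blast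
qed

end

locale finite_space = finite_field_space scale
  for scale :: "'a::{field,finite} \<Rightarrow> 'b::ab_group_add \<Rightarrow> 'b"  (infixr "*s" 75) +
  assumes finite_V: "finite (UNIV :: 'b set)"
begin

lemma finite_subset_V [simp]: "finite (S :: 'b set)"
  by (rule finite_subset[OF subset_UNIV finite_V])

lemma finite_subset_V2 [simp]: "finite (S :: ('b \<times> 'b) set)"
  by (rule finite_subset[OF subset_UNIV finite_Prod_UNIV[OF finite_V finite_V]])

lemma card_V_pos: "CARD('b) > 0"
  using finite_V by (simp add: card_gt_0_iff)

text \<open>Alternating forms have even rank: splitting off a hyperbolic plane enlarges the radical by the
  factor \<open>q\<^sup>2\<close> and leaves the form alternating. Such forms can be non-zero only in
  characteristic 2, where they have no vector \<open>u\<close> with \<open>f u u \<noteq> 0\<close> to split off.\<close>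

lemma alternating_even_rank:
  assumes "f \<in> symm_forms scale" "\<And>x. f x x = 0"
  shows "\<exists>j. card (form_rad f) * CARD('a) ^ (2 * j) = CARD('b)"
  using assms
proof (induction "CARD('b) - card (form_rad f)" arbitrary: f rule: less_induct)
  case less
  note f = less.prems(1) and alt = less.prems(2)
  show ?case
  proof (cases "form_rad f = UNIV")
    case True
    thus ?thesis by (intro exI[of _ 0]) simp
  next
    case False
    then obtain w v where wv: "f w v \<noteq> 0" by (auto simp: form_rad_def)
    define u where "u = inverse (f w v) *s w"
    have uv: "f u v = 1" using wv by (simp add: u_def symm_formsD[OF f])
    hence vu: "f v u = 1" using symm_forms_commute[OF f, of u v] by simp
    let ?g = "deflate_pair f u v"
    have v: "v \<notin> span (form_rad f)"
      unfolding span_form_rad[OF f] by (rule not_in_form_rad[of f v u]) (simp add: vu)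
    have "u - k *s v \<notin> form_rad f" for k
      by (rule not_in_form_rad[of f _ v]) (simp add: symm_formsD[OF f] uv alt)
    hence u: "u \<notin> span (insert v (form_rad f))"
      unfolding span_insert span_form_rad[OF f] by simp
    have card_g: "card (form_rad ?g) = CARD('a) ^ 2 * card (form_rad f)"
      using card_span_insert[OF _ u] card_span_insert[OF _ v]
      by (simp add: form_rad_deflate_pair[OF f alt uv] span_form_rad[OF f] power2_eq_square)
    have "card (form_rad f) > 0"
      using subspace_0[OF subspace_form_rad[OF f]] by (auto simp: card_gt_0_iff)
    moreover have "1 < CARD('a) ^ 2"
      using card_UNIV_field_ge2[where ?'a = 'a] by (intro one_less_power) auto
    ultimately have "card (form_rad f) < card (form_rad ?g)" unfolding card_g by simp
    moreover have "card (form_rad ?g) \<le> CARD('b)" by (rule card_mono) auto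
    ultimately have smaller: "CARD('b) - card (form_rad ?g) < CARD('b) - card (form_rad f)" by linarith
    have "?g x x = 0" for x
    proof -
      have "f (x + u) (x + u) = f x x + f u u + (f x u + f u x)"
        by (simp add: symm_formsD[OF f])
      hence "f x u + f u x = 0" by (simp add: alt)
      moreover have "?g x x = f x x - f x v * (f x u + f u x)"
        by (simp add: deflate_pair_def symm_forms_commute[OF f, of v x] algebra_simps)
      ultimately show ?thesis by (simp add: alt)
    qed
    then obtain j where "card (form_rad ?g) * CARD('a) ^ (2 * j) = CARD('b)"
      using less.hyps[OF smaller deflate_pair_symm_forms[OF f]] by blast
    thus ?thesis unfolding card_g
      by (intro exI[of _ "Suc j"]) (simp add: power2_eq_square mult_ac)
  qed
qed

lemma card_row_zeros:
  assumes "f \<in> symm_forms scale"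
  shows "real CARD('a) * real (card {y. f x y = 0}) =
    real CARD('b) * (if x \<in> form_rad f then real CARD('a) else 1)"
  using card_kernel[of UNIV "f x"] by (simp add: symm_formsD[OF assms] form_rad_def)

lemma card_bilinear_zeros:
  assumes "f \<in> symm_forms scale"
  shows "real CARD('a) * real (card {p. f (fst p) (snd p) = 0}) =
    real CARD('b) ^ 2 + (real CARD('a) - 1) * real (card (form_rad f)) * real CARD('b)"
proof -
  have "{p. f (fst p) (snd p) = 0} = (SIGMA x:UNIV. {y. f x y = 0})" by auto
  hence "real CARD('a) * real (card {p. f (fst p) (snd p) = 0}) =
      (\<Sum>x\<in>UNIV. real CARD('a) * real (card {y. f x y = 0}))"
    by (simp add: sum_distrib_left)
  also have "\<dots> = real CARD('b) * (\<Sum>x\<in>UNIV. if x \<in> form_rad f then real CARD('a) else 1)"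
    by (simp add: card_row_zeros[OF assms] sum_distrib_left)
  finally show ?thesis
    by (simp add: sum_if_const_card power2_eq_square algebra_simps)
qed

text \<open>Splitting off \<open>u\<close> makes the Hermitian form an orthogonal sum. Translation by \<open>span {u}\<close> changes only
  the norm-form summand.\<close>

lemma hermitian_form_translate:
  assumes f: "f \<in> symm_forms scale" and u: "f u u \<noteq> 0"
  shows "hermitian_form d f (x + \<alpha> *s u) (y + \<beta> *s u) = hermitian_form d (deflate f u) x y +
    norm_form d (f x u + \<alpha> * f u u) (f y u + \<beta> * f u u) / f u u"
proof -
  define a b c where "a = f x u" "b = f y u" "c = f u u"
  note abc = this
  have comm: "f u x = a" "f u y = b" "f x u = a" "f y u = b"
    using symm_forms_commute[OF f, of u x] symm_forms_commute[OF f, of u y] by (simp_all add: abc)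
  have c: "c \<noteq> 0" using u by (simp add: abc)
  have "(a + \<alpha> * c) * (a' + \<beta>' * c) / c = a * a' / c + (\<alpha> * a' + \<beta>' * a + \<alpha> * \<beta>' * c)"
    for a \<alpha> a' \<beta>' using c by (simp add: field_simps)
  note expand = this
  have "norm_form d (a + \<alpha> * c) (b + \<beta> * c) / c =
      (a + \<alpha> * c) * (a + \<alpha> * c) / c + (a + \<alpha> * c) * (b + \<beta> * c) / c +
      d * ((b + \<beta> * c) * (b + \<beta> * c) / c)"
    by (simp add: norm_form_def add_divide_distrib mult.assoc)
  also have "\<dots> = (a * a / c + (\<alpha> * a + \<alpha> * a + \<alpha> * \<alpha> * c)) +
      (a * b / c + (\<alpha> * b + \<beta> * a + \<alpha> * \<beta> * c)) +
      d * (b * b / c + (\<beta> * b + \<beta> * b + \<beta> * \<beta> * c))"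
    unfolding expand ..
  finally show ?thesis
    unfolding hermitian_form_def deflate_def symm_formsD[OF f] comm abc(3)[symmetric]
    by (simp only:) (simp add: algebra_simps)
qed

text \<open>On each coset of the plane \<open>{(\<alpha> *s u, \<beta> *s u)}\<close> the deflated form is constant, and the remaining
  norm form takes the value that cancels it once or \<open>q + 1\<close> times.\<close>

lemma card_hermitian_zeros_deflate:
  assumes d: "\<forall>x. x * x + x + d \<noteq> 0" and f: "f \<in> symm_forms scale" and u: "f u u \<noteq> 0"
  shows "real CARD('a) ^ 2 * real (card {p. hermitian_form d f (fst p) (snd p) = 0}) =
    (real CARD('a) + 1) * real CARD('b) ^ 2 -
    real CARD('a) * real (card {p. hermitian_form d (deflate f u) (fst p) (snd p) = 0})"
proof -
  define h where "h g p = hermitian_form d g (fst p) (snd p)" for g :: "'b \<Rightarrow> 'b \<Rightarrow> 'a" and p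
  define T where "T s p = (fst p + fst s *s u, snd p + snd s *s u)" for s :: "'a \<times> 'a" and p
  have orbit: "card {s. h f (T s p) = 0} = (if h (deflate f u) p = 0 then 1 else CARD('a) + 1)" for p
  proof -
    obtain x y where p: "p = (x, y)" by fastforce
    let ?e = "- hermitian_form d (deflate f u) x y * f u u"
    let ?L = "\<lambda>s. (f x u + fst s * f u u, f y u + snd s * f u u)"
    have "h f (T s p) = 0 \<longleftrightarrow> norm_form d (fst (?L s)) (snd (?L s)) = ?e" for s
      using hermitian_form_translate[OF f u, of d x "fst s" y "snd s"] u
      by (simp add: h_def T_def p divide_eq_eq add_eq_0_iff)
    hence "{s. h f (T s p) = 0} = ?L -` {t. norm_form d (fst t) (snd t) = ?e}" by auto
    moreover have "inj ?L" using u by (auto intro!: injI simp: prod_eq_iff)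
    moreover have "t \<in> range ?L" for t
      by (rule image_eqI[of _ _ "((fst t - f x u) / f u u, (snd t - f y u) / f u u)"]) (use u in auto)
    hence "{t. norm_form d (fst t) (snd t) = ?e} \<subseteq> range ?L" by blast
    ultimately have "card {s. h f (T s p) = 0} = card {t. norm_form d (fst t) (snd t) = ?e}"
      by (simp only: card_vimage_inj)
    moreover have "card {t. norm_form d (fst t) (snd t) = ?e} =
        (if h (deflate f u) p = 0 then 1 else CARD('a) + 1)"
    proof (cases "hermitian_form d (deflate f u) x y = 0")
      case True
      have "{t. norm_form d (fst t) (snd t) = 0} = {(0, 0)}"
        unfolding norm_form_eq_0_iff[OF d] by (auto simp: prod_eq_iff)
      thus ?thesis using True by (simp add: h_def p)
    next
      case False
      have "{t. norm_form d (fst t) (snd t) = ?e} = {(a, b). norm_form d a b = ?e}" by auto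
      thus ?thesis using card_norm_form_fiber[OF d, of ?e] False u by (simp add: h_def p)
    qed
    ultimately show ?thesis by simp
  qed
  have "card {p. h f (T s p) = 0} = card {p. h f p = 0}" for s
  proof -
    have "inj (T s)" by (auto intro!: injI simp: T_def prod_eq_iff)
    moreover have "p \<in> range (T s)" for p
      by (rule image_eqI[of _ _ "(fst p - fst s *s u, snd p - snd s *s u)"]) (auto simp: T_def)
    hence "{p. h f p = 0} \<subseteq> range (T s)" by blast
    ultimately have "card (T s -` {p. h f p = 0}) = card {p. h f p = 0}"
      by (simp only: card_vimage_inj)
    thus ?thesis by (simp add: vimage_def)
  qed
  hence "real CARD('a) ^ 2 * real (card {p. h f p = 0}) =
      (\<Sum>s\<in>(UNIV :: ('a \<times> 'a) set). real (card {p \<in> UNIV. h f (T s p) = 0}))"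
    by (simp add: power2_eq_square)
  also have "\<dots> = (\<Sum>p\<in>UNIV. real (card {s \<in> UNIV. h f (T s p) = 0}))"
    by (rule sum_card_swap) auto
  also have "\<dots> = (\<Sum>p\<in>UNIV. if h (deflate f u) p = 0 then 1 else real CARD('a) + 1)"
    by (rule sum.cong) (auto simp: orbit)
  also have "\<dots> = real (card {p \<in> UNIV. h (deflate f u) p = 0}) * (1 - (real CARD('a) + 1)) +
      real CARD('b \<times> 'b) * (real CARD('a) + 1)"
    by (rule sum_if_const_card) simp
  also have "\<dots> = (real CARD('a) + 1) * real CARD('b) ^ 2 -
      real CARD('a) * real (card {p. h (deflate f u) p = 0})"
    by (simp add: power2_eq_square)
  finally show ?thesis unfolding h_def .
qed

text \<open>Each split-off vector contributes a factor \<open>-1 / q\<close> to the deviation of the number of zeros from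
  its average; this is the source of the sign. Non-zero alternating forms allow no such step, but for
  them the Hermitian value at \<open>x + \<omega> * y\<close> is just \<open>f x y\<close>, and their rank is even. The exponent \<open>k\<close>
  is the rank, expressed through cardinalities.\<close>

lemma card_hermitian_zeros:
  assumes d: "\<forall>x. x * x + x + d \<noteq> 0" and "f \<in> symm_forms scale"
  shows "\<exists>k. card (form_rad f) * CARD('a) ^ k = CARD('b) \<and>
    real CARD('a) * real (card {p. hermitian_form d f (fst p) (snd p) = 0}) =
      real CARD('b) ^ 2 + (real CARD('a) - 1) * (-1) ^ k * real (card (form_rad f)) * real CARD('b)"
  using assms(2)
proof (induction "CARD('b) - card (form_rad f)" arbitrary: f rule: less_induct)
  case less
  note f = less.prems(1)
  show ?case
  proof (cases "\<forall>x. f x x = 0")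
    case True
    then obtain j where "card (form_rad f) * CARD('a) ^ (2 * j) = CARD('b)"
      using alternating_even_rank[OF f] by auto
    moreover have "hermitian_form d f x y = f x y" for x y
      using True by (simp add: hermitian_form_def)
    moreover have "(-1 :: real) ^ (2 * j) = 1" by simp
    ultimately show ?thesis
      using card_bilinear_zeros[OF f] by (intro exI[of _ "2 * j"]) simp
  next
    case False
    then obtain u where u: "f u u \<noteq> 0" by blast
    let ?g = "deflate f u" and ?q = "real CARD('a)"
    have "u \<notin> span (form_rad f)" unfolding span_form_rad[OF f] by (rule not_in_form_rad[of f u u, OF u])
    hence card_g: "card (form_rad ?g) = CARD('a) * card (form_rad f)"
      using card_span_insert[of "form_rad f" u] by (simp add: form_rad_deflate[OF f u] span_form_rad[OF f])
    have "card (form_rad f) > 0"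
      using subspace_0[OF subspace_form_rad[OF f]] by (auto simp: card_gt_0_iff)
    hence "card (form_rad f) < card (form_rad ?g)"
      unfolding card_g using card_UNIV_field_ge2[where ?'a = 'a] by simp
    moreover have "card (form_rad ?g) \<le> CARD('b)" by (rule card_mono) auto
    ultimately have smaller: "CARD('b) - card (form_rad ?g) < CARD('b) - card (form_rad f)" by linarith
    obtain k where k: "card (form_rad ?g) * CARD('a) ^ k = CARD('b)"
      "?q * real (card {p. hermitian_form d ?g (fst p) (snd p) = 0}) =
        real CARD('b) ^ 2 + (?q - 1) * (-1) ^ k * real (card (form_rad ?g)) * real CARD('b)"
      using less.hyps[OF smaller deflate_symm_forms[OF f]] by blast
    let ?Z = "real (card {p. hermitian_form d f (fst p) (snd p) = 0})"
    have "?q * (?q * ?Z) = ?q * (real CARD('b) ^ 2 +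
        (?q - 1) * (-1) ^ Suc k * real (card (form_rad f)) * real CARD('b))"
      using card_hermitian_zeros_deflate[OF d f u] k(2)
      unfolding card_g by (simp add: power2_eq_square algebra_simps)
    hence "?q * ?Z = real CARD('b) ^ 2 +
        (?q - 1) * (-1) ^ Suc k * real (card (form_rad f)) * real CARD('b)"
      using CARD_ge2 by simp
    moreover have "card (form_rad f) * CARD('a) ^ Suc k = CARD('b)"
      using k(1) unfolding card_g by (simp add: mult_ac)
    ultimately show ?thesis by blast
  qed
qed

end

section \<open>Subspaces of symmetric forms\<close>

definition annihilator :: "('v \<Rightarrow> 'v \<Rightarrow> 'a::zero) set \<Rightarrow> 'v \<Rightarrow> 'v set" where
  "annihilator N x = {y. \<forall>f\<in>N. f x y = 0}"

context finite_space
begin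

lemma finite_forms [simp]: "finite (N :: ('b \<Rightarrow> 'b \<Rightarrow> 'a) set)"
proof -
  have "finite (UNIV :: ('b \<Rightarrow> 'a) set)" using finite_V by (simp add: finite_UNIV_fun)
  hence "finite (UNIV :: ('b \<Rightarrow> 'b \<Rightarrow> 'a) set)" using finite_V by (simp add: finite_UNIV_fun)
  thus ?thesis by (rule finite_subset[OF subset_UNIV])
qed

lemma subspace_forms_killing:
  "forms.subspace N \<Longrightarrow> forms.subspace (forms_killing N u)"
  by (simp add: forms.subspace_def forms_killing_def form_rad_def form_scale_def)

text \<open>The forms restricted to the row \<open>x\<close> are functionals on \<open>V\<close>, and \<open>annihilator N x\<close> is their
  common kernel; this is the rank-nullity theorem for \<open>f \<mapsto> f x\<close>, obtained by counting the pairs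
  \<open>(f, y)\<close> with \<open>f x y = 0\<close> in two ways.\<close>

lemma card_annihilator:
  assumes N: "forms.subspace N" "N \<subseteq> symm_forms scale"
  shows "real (card N) * real (card (annihilator N x)) =
    real CARD('b) * real (card (forms_killing N x))"
proof -
  let ?q = "real CARD('a)" and ?B = "real CARD('b)"
  have "real (card N) * ((?q - 1) * real (card {y \<in> UNIV. \<forall>f\<in>N. f x y = 0}) + ?B) =
      ?q * (\<Sum>f\<in>N. real (card {y \<in> UNIV. f x y = 0}))"
    by (rule forms.sum_card_zeros[symmetric]) (use N in \<open>auto simp: form_scale_def\<close>)
  also have "\<dots> = (\<Sum>f\<in>N. ?B * (if x \<in> form_rad f then ?q else 1))"
    unfolding sum_distrib_left
  proof (rule sum.cong)
    fix f assume "f \<in> N"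
    hence "f \<in> symm_forms scale" using N by blast
    from card_row_zeros[OF this, of x]
    show "?q * real (card {y \<in> UNIV. f x y = 0}) = ?B * (if x \<in> form_rad f then ?q else 1)" by simp
  qed simp
  also have "\<dots> = ?B * (\<Sum>f\<in>N. if x \<in> form_rad f then ?q else 1)"
    by (simp only: sum_distrib_left)
  also have "(\<Sum>f\<in>N. if x \<in> form_rad f then ?q else 1) =
      real (card {f \<in> N. x \<in> form_rad f}) * (?q - 1) + real (card N) * 1"
    by (rule sum_if_const_card) simp
  finally have "(?q - 1) * (real (card N) * real (card (annihilator N x))) =
      (?q - 1) * (?B * real (card (forms_killing N x)))"
    by (simp add: annihilator_def forms_killing_def algebra_simps)
  thus ?thesis using CARD_ge2 by simp
qed

lemma card_common_bilinear_zeros: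
  assumes N: "forms.subspace N" "N \<subseteq> symm_forms scale"
  shows "real (card N) * real (card {p. \<forall>f\<in>N. f (fst p) (snd p) = 0}) =
    real CARD('b) * (\<Sum>f\<in>N. real (card (form_rad f)))"
proof -
  have "{p. \<forall>f\<in>N. f (fst p) (snd p) = 0} = (SIGMA x:UNIV. annihilator N x)"
    by (auto simp: annihilator_def)
  hence "real (card N) * real (card {p. \<forall>f\<in>N. f (fst p) (snd p) = 0}) =
      (\<Sum>x\<in>UNIV. real (card N) * real (card (annihilator N x)))"
    by (simp add: sum_distrib_left)
  also have "\<dots> = real CARD('b) * (\<Sum>x\<in>UNIV. real (card {f \<in> N. x \<in> form_rad f}))"
    by (simp add: card_annihilator[OF N] forms_killing_def sum_distrib_left)
  also have "(\<Sum>x\<in>UNIV. real (card {f \<in> N. x \<in> form_rad f})) =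
      (\<Sum>f\<in>N. real (card {x \<in> UNIV. x \<in> form_rad f}))"
    by (rule sum_card_swap) auto
  finally show ?thesis by simp
qed

lemma card_common_hermitian_zeros:
  assumes d: "\<forall>x. x * x + x + d \<noteq> 0"
    and N: "forms.subspace N" "N \<subseteq> symm_forms scale"
    and k: "\<And>f. f \<in> N \<Longrightarrow> card (form_rad f) * CARD('a) ^ k f = CARD('b)"
  shows "real (card N) * real (card {p. \<forall>f\<in>N. hermitian_form d f (fst p) (snd p) = 0}) =
    real CARD('b) * (\<Sum>f\<in>N. (-1) ^ k f * real (card (form_rad f)))"
proof -
  let ?q = "real CARD('a)" and ?B = "real CARD('b)"
  have "real (card N) * ((?q - 1) *
        real (card {p \<in> UNIV. \<forall>f\<in>N. hermitian_form d f (fst p) (snd p) = 0}) +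
        real CARD('b \<times> 'b)) =
      ?q * (\<Sum>f\<in>N. real (card {p \<in> UNIV. hermitian_form d f (fst p) (snd p) = 0}))"
    by (rule forms.sum_card_zeros[symmetric])
       (use N in \<open>auto simp: form_scale_def hermitian_form_def algebra_simps\<close>)
  also have "\<dots> = (\<Sum>f\<in>N. ?B ^ 2 + ((?q - 1) * ?B) * ((-1) ^ k f * real (card (form_rad f))))"
    unfolding sum_distrib_left
  proof (rule sum.cong)
    fix f assume f: "f \<in> N"
    hence "f \<in> symm_forms scale" using N by blast
    from card_hermitian_zeros[OF d this] obtain l
      where l: "card (form_rad f) * CARD('a) ^ l = CARD('b)"
        "?q * real (card {p. hermitian_form d f (fst p) (snd p) = 0}) =
          ?B ^ 2 + (?q - 1) * (-1) ^ l * real (card (form_rad f)) * ?B" by blast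
    have "card (form_rad f) > 0" using l(1) card_V_pos by (metis gr0I mult_0)
    hence "CARD('a) ^ l = CARD('a) ^ k f" using l(1) k[OF f] by (metis mult_cancel1 less_irrefl)
    hence "l = k f" using card_UNIV_field_ge2[where ?'a = 'a] by (simp add: power_inject_exp)
    thus "?q * real (card {p \<in> UNIV. hermitian_form d f (fst p) (snd p) = 0}) =
        ?B ^ 2 + ((?q - 1) * ?B) * ((-1) ^ k f * real (card (form_rad f)))"
      using l(2) by (simp add: mult_ac)
  qed simp
  also have "\<dots> = real (card N) * ?B ^ 2 +
      ((?q - 1) * ?B) * (\<Sum>f\<in>N. (-1) ^ k f * real (card (form_rad f)))"
    by (simp add: sum.distrib sum_distrib_left)
  finally have "(?q - 1) * (real (card N) *
        real (card {p. \<forall>f\<in>N. hermitian_form d f (fst p) (snd p) = 0})) =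
      (?q - 1) * (?B * (\<Sum>f\<in>N. (-1) ^ k f * real (card (form_rad f))))"
    by (simp add: power2_eq_square algebra_simps)
  thus ?thesis using CARD_ge2 by simp
qed

lemma card_span_singleton:
  assumes "u \<noteq> 0"
  shows "card (span {u}) = CARD('a)"
  using card_span_insert[of "{}" u] assms by simp

lemma card_span_pair:
  assumes "u \<noteq> 0" "v \<notin> span {u}"
  shows "card (span {u, v}) = CARD('a) ^ 2"
  using card_span_insert[of "{u}" v] assms
  by (simp add: card_span_singleton insert_commute power2_eq_square)

lemma subspace_card_sq_basis:
  assumes "subspace S" "card S = CARD('a) ^ 2"
  obtains u v where "u \<noteq> 0" "v \<notin> span {u}" "S = span {u, v}"
proof -
  have q: "CARD('a) \<ge> 2" "CARD('a) < CARD('a) ^ 2"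
    by (rule card_UNIV_field_ge2 card_field_less_square)+
  have "\<not> S \<subseteq> {0}"
  proof
    assume "S \<subseteq> {0}"
    hence "card S \<le> card {0 :: 'b}" by (intro card_mono) auto
    thus False using assms(2) q by simp
  qed
  then obtain u where u: "u \<in> S" "u \<noteq> 0" by blast
  have "\<not> S \<subseteq> span {u}"
  proof
    assume "S \<subseteq> span {u}"
    hence "card S \<le> card (span {u})" by (intro card_mono) auto
    thus False using assms(2) q by (simp add: card_span_singleton[OF u(2)])
  qed
  then obtain v where v: "v \<in> S" "v \<notin> span {u}" by blast
  have "span {u, v} \<subseteq> S" using u v assms(1) by (intro span_minimal) auto
  hence "span {u, v} = S"
    using card_span_pair[OF u(2) v(2)] assms(2) by (intro card_subset_eq) simp_all
  thus thesis using that[OF u(2) v(2)] by blast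
qed

lemma card_independent_pairs:
  assumes S: "subspace S"
  shows "real (card {p. fst p \<noteq> 0 \<and> snd p \<notin> span {fst p} \<and> fst p \<in> S \<and> snd p \<in> S}) =
    (real (card S) - 1) * (real (card S) - real CARD('a))"
proof -
  have 0: "0 \<in> S" by (rule subspace_0[OF S])
  have "{p. fst p \<noteq> 0 \<and> snd p \<notin> span {fst p} \<and> fst p \<in> S \<and> snd p \<in> S} =
      (SIGMA u:S - {0}. S - span {u})" by auto
  moreover have "real (card (S - span {u})) = real (card S) - real CARD('a)" if u: "u \<in> S - {0}" for u
  proof -
    have "span {u} \<subseteq> S" using u S by (intro span_minimal) auto
    moreover from this have "card (span {u}) \<le> card S" by (intro card_mono) auto
    ultimately show ?thesis using u by (simp add: card_Diff_subset card_span_singleton of_nat_diff)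
  qed
  hence "(\<Sum>u\<in>S - {0}. real (card (S - span {u}))) =
      (\<Sum>u\<in>S - {0}. real (card S) - real CARD('a))" by (rule sum.cong[OF refl])
  moreover have "card S > 0" using 0 by (auto simp: card_gt_0_iff)
  hence "real (card (S - {0})) = real (card S) - 1"
    using 0 by (simp add: card_Diff_singleton of_nat_diff)
  ultimately show ?thesis by simp
qed

text \<open>Since \<open>(q + 1) * R f + (q - 1) * (-1) ^ rank f * R f\<close> has the same value \<open>2 * q\<^sup>2\<close> on the two
  possible non-zero ranks, the two zero counts combine to an equation in \<open>card N\<close>, \<open>h\<close> and
  \<open>e\<close> alone. There \<open>h\<close> and \<open>e\<close> are the excesses over the zeros forced by \<open>u\<close>; the equation reads
  \<open>|N| * ((q + 1) * h + (q - 1) * e) = (B - |N|) * (2 * q * (B - q))\<close>, so \<open>card N \<ge> B\<close> leaves only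
  equality and \<open>h = e = 0\<close>.\<close>

lemma killed_by_extremal:
  assumes N: "forms.subspace N" "N \<subseteq> symm_forms scale"
    and u: "u \<noteq> 0" "\<And>f. f \<in> N \<Longrightarrow> u \<in> form_rad f"
    and n: "n \<ge> 3" "odd n" "CARD('b) = CARD('a) ^ n"
    and rad: "\<And>f. f \<in> N \<Longrightarrow> f \<noteq> 0 \<Longrightarrow>
      card (form_rad f) = CARD('a) \<or> card (form_rad f) = CARD('a) ^ 2"
    and large: "card N \<ge> CARD('b)"
  shows "card N = CARD('b)" "\<And>v. v \<notin> span {u} \<Longrightarrow> annihilator N v = span {u}"
proof -
  obtain d where d: "\<forall>x::'a. x * x + x + d \<noteq> 0" using irreducible_quadratic_exists by blast
  let ?q = "real CARD('a)" and ?B = "real CARD('b)" and ?N = "real (card N)"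
  let ?R = "\<lambda>f. real (card (form_rad f))"
  let ?H = "{p. \<forall>f\<in>N. f (fst p) (snd p) = 0}"
  let ?E = "{p. \<forall>f\<in>N. hermitian_form d f (fst p) (snd p) = 0}"
  let ?S = "span {u} \<times> UNIV \<union> UNIV \<times> span {u}"
  have q2: "CARD('a) \<ge> 2" by (rule card_UNIV_field_ge2)
  have zero: "0 \<in> N" using N(1) by (rule forms.subspace_0)
  have rad0: "form_rad (0 :: 'b \<Rightarrow> 'b \<Rightarrow> 'a) = UNIV" by (auto simp: form_rad_def)

  \<comment> \<open>The rank of \<open>f\<close>; as \<open>n\<close> is odd, rank \<open>n - 1\<close> has sign \<open>1\<close> and rank \<open>n - 2\<close> has sign \<open>-1\<close>.\<close>
  define k where "k f = (if f = 0 then 0 else if card (form_rad f) = CARD('a) then n - 1 else n - 2)"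
    for f :: "'b \<Rightarrow> 'b \<Rightarrow> 'a"
  have k: "card (form_rad f) * CARD('a) ^ k f = CARD('b)" if "f \<in> N" for f
  proof -
    have "CARD('a) * CARD('a) ^ (n - 1) = CARD('a) ^ n"
      using n by (simp flip: power_Suc)
    moreover have "CARD('a) ^ 2 * CARD('a) ^ (n - 2) = CARD('a) ^ n"
      unfolding power_add[symmetric]
      by (rule arg_cong[of _ _ "power CARD('a)"]) (use n in simp)
    ultimately show ?thesis using rad[OF that] n(3) by (auto simp: k_def rad0)
  qed
  have weight: "(?q + 1) * ?R f + (?q - 1) * ((-1) ^ k f * ?R f) =
      (if f = 0 then 2 * ?q * ?B else 2 * ?q ^ 2)" if "f \<in> N" for f
  proof -
    have "even (n - 1)" "odd (n - 2)" using n by auto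
    hence "(-1 :: real) ^ (n - 1) = 1" "(-1 :: real) ^ (n - 2) = -1" by simp_all
    moreover have "CARD('a) ^ 2 \<noteq> CARD('a)" using q2 by (simp add: power2_eq_square)
    ultimately show ?thesis using rad[OF that]
      by (auto simp: k_def rad0 power2_eq_square algebra_simps)
  qed
  have sumH: "?N * real (card ?H) = ?B * (\<Sum>f\<in>N. ?R f)"
    by (rule card_common_bilinear_zeros[OF N])
  have sumE: "?N * real (card ?E) = ?B * (\<Sum>f\<in>N. (-1) ^ k f * ?R f)"
    by (rule card_common_hermitian_zeros[OF d N k])
  have "?N * ((?q + 1) * real (card ?H) + (?q - 1) * real (card ?E)) =
      (?q + 1) * (?N * real (card ?H)) + (?q - 1) * (?N * real (card ?E))"
    by (simp add: algebra_simps)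
  also have "\<dots> = ?B * (\<Sum>f\<in>N. (?q + 1) * ?R f + (?q - 1) * ((-1) ^ k f * ?R f))"
    unfolding sumH sumE sum.distrib sum_distrib_left[symmetric] by (simp add: algebra_simps)
  also have "(\<Sum>f\<in>N. (?q + 1) * ?R f + (?q - 1) * ((-1) ^ k f * ?R f)) =
      (\<Sum>f\<in>N. if f = 0 then 2 * ?q * ?B else 2 * ?q ^ 2)"
    using weight by (rule sum.cong[OF refl])
  also have "\<dots> = real (card {f \<in> N. f = 0}) * (2 * ?q * ?B - 2 * ?q ^ 2) + ?N * (2 * ?q ^ 2)"
    by (rule sum_if_const_card) simp
  also have "{f \<in> N. f = 0} = {0}" using zero by blast
  finally have total: "?N * ((?q + 1) * real (card ?H) + (?q - 1) * real (card ?E)) =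
      ?B * (2 * ?q * ?B - 2 * ?q ^ 2 + ?N * (2 * ?q ^ 2))" by simp

  have kill: "f x y = 0" "f y x = 0" if "f \<in> N" "x \<in> span {u}" for f x y
  proof -
    have f: "f \<in> symm_forms scale" using that N by blast
    have "span {u} \<subseteq> form_rad f" using u(2)[OF that(1)]
      by (intro span_minimal subspace_form_rad[OF f]) simp
    with that show "f x y = 0" unfolding form_rad_def by blast
    thus "f y x = 0" using symm_forms_commute[OF f, of x y] by simp
  qed
  \<comment> \<open>The zeros forced by \<open>u\<close>: \<open>2 * q * B - q\<^sup>2\<close> bilinear ones and \<open>q\<^sup>2\<close> Hermitian ones.\<close>
  have S: "?S \<subseteq> ?H" using kill by auto
  have "span {u} \<times> span {u} \<subseteq> ?E"
  proof clarsimp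
    fix a b f assume ab: "a \<in> span {u}" "b \<in> span {u}" and f: "f \<in> N"
    have "f a a = 0" "f a b = 0" "f b b = 0" using kill(1)[OF f] ab by blast+
    thus "hermitian_form d f a b = 0" by (simp add: hermitian_form_def)
  qed
  hence "card (span {u} \<times> span {u}) \<le> card ?E" by (intro card_mono) auto
  hence "CARD('a) ^ 2 \<le> card ?E"
    unfolding card_cartesian_product card_span_singleton[OF u(1)] power2_eq_square .
  hence "real (CARD('a) ^ 2) \<le> real (card ?E)" by (simp only: of_nat_le_iff)
  hence E: "?q ^ 2 \<le> real (card ?E)" by (simp only: of_nat_power)
  have "card (span {u} \<times> (UNIV :: 'b set)) + card ((UNIV :: 'b set) \<times> span {u}) =
      card ?S + card (span {u} \<times> (UNIV :: 'b set) \<inter> UNIV \<times> span {u})"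
    by (rule card_Un_Int) auto
  also have "span {u} \<times> (UNIV :: 'b set) \<inter> UNIV \<times> span {u} = span {u} \<times> span {u}" by auto
  finally have "CARD('a) * CARD('b) + CARD('b) * CARD('a) = card ?S + CARD('a) * CARD('a)"
    unfolding card_cartesian_product card_span_singleton[OF u(1)] .
  hence "real (CARD('a) * CARD('b) + CARD('b) * CARD('a)) = real (card ?S + CARD('a) * CARD('a))"
    by (rule arg_cong)
  hence card_S: "real (card ?S) = 2 * ?q * ?B - ?q ^ 2"
    unfolding of_nat_add of_nat_mult by (simp add: power2_eq_square algebra_simps)
  have H: "real (card ?S) \<le> real (card ?H)" using S by (simp add: card_mono)

  have Bq: "?B > ?q"
  proof -
    have "CARD('a) ^ 1 < CARD('a) ^ n" using q2 n by (intro power_strict_increasing) auto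
    thus ?thesis unfolding n(3) by simp
  qed
  define h where "h = real (card ?H) - (2 * ?q * ?B - ?q ^ 2)"
  define e where "e = real (card ?E) - ?q ^ 2"
  have he: "h \<ge> 0" "e \<ge> 0" using E H card_S by (simp_all add: h_def e_def)
  have H_eq: "real (card ?H) = h + (2 * ?q * ?B - ?q ^ 2)" by (simp add: h_def)
  have E_eq: "real (card ?E) = e + ?q ^ 2" by (simp add: e_def)
  have key: "?N * ((?q + 1) * h + (?q - 1) * e) = (?B - ?N) * (2 * ?q * (?B - ?q))"
    using total unfolding H_eq E_eq by (simp add: power2_eq_square algebra_simps)
  have q: "?q \<ge> 2" by (rule CARD_ge2)
  have NB: "?N \<ge> ?B" using large by simp
  have pos: "?N > 0" using NB card_V_pos by linarith
  have nonneg: "(?q + 1) * h \<ge> 0" "(?q - 1) * e \<ge> 0" using he q by simp_all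
  have "?B - ?N \<ge> 0"
  proof (rule ccontr)
    assume "\<not> ?B - ?N \<ge> 0"
    hence "(?B - ?N) * (2 * ?q * (?B - ?q)) < 0" using q Bq by (intro mult_neg_pos) simp_all
    moreover have "?N * ((?q + 1) * h + (?q - 1) * e) \<ge> 0"
      using nonneg pos by (intro mult_nonneg_nonneg) simp_all
    ultimately show False using key by linarith
  qed
  hence eq: "?N = ?B" using NB by linarith
  thus "card N = CARD('b)" by (simp only: of_nat_eq_iff)
  have "(?q + 1) * h + (?q - 1) * e = 0" using key eq pos by simp
  hence "(?q + 1) * h = 0" using nonneg by linarith
  hence "h = 0" using q by simp
  hence "card ?S = card ?H" using card_S by (simp add: h_def)
  hence "?S = ?H" using S by (intro card_subset_eq) auto
  show "annihilator N v = span {u}" if v: "v \<notin> span {u}" for v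
  proof -
    have "y \<in> annihilator N v \<longleftrightarrow> (v, y) \<in> ?H" for y by (simp add: annihilator_def)
    moreover have "(v, y) \<in> ?S \<longleftrightarrow> y \<in> span {u}" for y using v by simp
    ultimately show ?thesis unfolding \<open>?S = ?H\<close> by blast
  qed
qed

end

section \<open>Extremal subspaces of symmetric forms\<close>

text \<open>The hypotheses of the theorem in terms of cardinalities: \<open>card_M\<close> is \<open>dim M = 2 * n\<close>, and
  \<open>card_rad\<close> is the lower bound \<open>n - 2\<close> on the rank.\<close>

locale extremal_forms = finite_space scale
  for scale :: "'a::{field,finite} \<Rightarrow> 'b::ab_group_add \<Rightarrow> 'b"  (infixr "*s" 75) +
  fixes M :: "('b \<Rightarrow> 'b \<Rightarrow> 'a) set" and n :: nat
  assumes n: "n \<ge> 3" "odd n" and card_V: "CARD('b) = CARD('a) ^ n"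
    and M: "forms.subspace M" "M \<subseteq> symm_forms scale"
    and card_M: "card M = CARD('b) ^ 2"
    and card_rad: "f \<in> M \<Longrightarrow> f \<noteq> 0 \<Longrightarrow> card (form_rad f) \<in> {1, CARD('a), CARD('a) ^ 2}"
begin

text \<open>The map \<open>f \<mapsto> f u\<close> sends \<open>M\<close>, of size \<open>B\<^sup>2\<close>, to the dual of \<open>V\<close>, of size \<open>B\<close>, so its kernel
  \<open>forms_killing M u\<close> has at least \<open>B\<close> elements and is extremal.\<close>

lemma card_M_u:
  assumes u: "u \<noteq> 0"
  shows "card (forms_killing M u) = CARD('b)"
    and "v \<notin> span {u} \<Longrightarrow> annihilator (forms_killing M u) v = span {u}"
proof -
  let ?N = "forms_killing M u"
  have symm: "f \<in> symm_forms scale" if "f \<in> M" for f using that M by blast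
  have "0 \<in> annihilator M u" using symm_formsD(6)[OF symm] by (simp add: annihilator_def)
  hence "card (annihilator M u) > 0" by (auto simp: card_gt_0_iff)
  moreover have "card M * card (annihilator M u) = CARD('b) * card ?N"
    using card_annihilator[OF M, of u] by (simp flip: of_nat_mult)
  hence "card ?N = CARD('b) * card (annihilator M u)"
    using card_V_pos unfolding card_M by (simp add: power2_eq_square)
  ultimately have large: "card ?N \<ge> CARD('b)" by simp
  have sub: "forms.subspace ?N" "?N \<subseteq> symm_forms scale"
    using subspace_forms_killing[OF M(1)] M(2) by (auto simp: forms_killing_def)
  have u_rad: "u \<in> form_rad f" if "f \<in> ?N" for f using that by (simp add: forms_killing_def)
  have rad: "card (form_rad f) = CARD('a) \<or> card (form_rad f) = CARD('a) ^ 2"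
    if f: "f \<in> ?N" "f \<noteq> 0" for f
  proof -
    have "f \<in> M" using f by (simp add: forms_killing_def)
    have "{0, u} \<subseteq> form_rad f"
      using u_rad[OF f(1)] subspace_0[OF subspace_form_rad[OF symm[OF \<open>f \<in> M\<close>]]] by simp
    hence "card {0, u} \<le> card (form_rad f)" by (intro card_mono) auto
    hence "card (form_rad f) \<noteq> 1" using u by simp
    thus ?thesis using card_rad[OF \<open>f \<in> M\<close> f(2)] by blast
  qed
  show "card (forms_killing M u) = CARD('b)"
    by (rule killed_by_extremal(1)[OF sub u u_rad n card_V rad large])
  show "v \<notin> span {u} \<Longrightarrow> annihilator (forms_killing M u) v = span {u}"
    by (rule killed_by_extremal(2)[OF sub u u_rad n card_V rad large])
qed

lemma forms_killing_Int:
  "forms_killing M u \<inter> forms_killing M v = forms_killing (forms_killing M u) v"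
  by (auto simp: forms_killing_def)

text \<open>The functionals \<open>f v\<close> with \<open>f \<in> forms_killing M u\<close> have the common kernel \<open>span {u}\<close>, so they fill
  a space of codimension \<open>1\<close> in the dual of \<open>V\<close>, and rank-nullity leaves a one-dimensional kernel of \<open>f \<mapsto> f v\<close>.\<close>

lemma card_M_u_Int_M_v:
  assumes u: "u \<noteq> 0" and v: "v \<notin> span {u}"
  shows "card (forms_killing M u \<inter> forms_killing M v) = CARD('a)"
proof -
  let ?N = "forms_killing M u"
  have sub: "forms.subspace ?N" "?N \<subseteq> symm_forms scale"
    using subspace_forms_killing[OF M(1)] M(2) by (auto simp: forms_killing_def)
  have "card ?N * card (annihilator ?N v) = CARD('b) * card (forms_killing ?N v)"
    using card_annihilator[OF sub, of v] by (simp flip: of_nat_mult)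
  hence "card (forms_killing ?N v) = CARD('a)"
    using card_V_pos by (simp add: card_M_u(1)[OF u] card_M_u(2)[OF u v] card_span_singleton[OF u])
  thus ?thesis by (simp add: forms_killing_Int)
qed

lemma M_u_Int_M_v_eq_span:
  assumes u: "u \<noteq> 0" and v: "v \<notin> span {u}"
    and f: "f \<in> forms_killing M u \<inter> forms_killing M v" "f \<noteq> 0"
  shows "form_rad f = span {u, v}"
    and "forms_killing M u \<inter> forms_killing M v = forms.span {f}"
proof -
  have fM: "f \<in> M" "u \<in> form_rad f" "v \<in> form_rad f" using f by (auto simp: forms_killing_def)
  hence symm: "f \<in> symm_forms scale" using M by blast
  have le: "span {u, v} \<subseteq> form_rad f"
    using fM by (intro span_minimal subspace_form_rad[OF symm]) simp
  hence "CARD('a) ^ 2 \<le> card (form_rad f)"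
    using card_mono[OF _ le] by (simp add: card_span_pair[OF u v])
  hence "card (form_rad f) = CARD('a) ^ 2"
    using card_rad[OF fM(1) f(2)] card_field_less_square[where ?'a = 'a]
      card_UNIV_field_ge2[where ?'a = 'a] by auto
  hence "span {u, v} = form_rad f"
    using le by (intro card_subset_eq) (simp_all add: card_span_pair[OF u v])
  thus "form_rad f = span {u, v}" ..
  have "forms.subspace (forms_killing M u \<inter> forms_killing M v)"
    unfolding forms_killing_Int by (intro subspace_forms_killing M)
  hence "forms.span {f} \<subseteq> forms_killing M u \<inter> forms_killing M v"
    using f by (intro forms.span_minimal) auto
  moreover have "card (forms.span {f}) = CARD('a)"
    using forms.card_span_insert[of "{}" f] f(2) by simp
  ultimately have "forms.span {f} = forms_killing M u \<inter> forms_killing M v"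
    by (intro card_subset_eq) (simp_all add: card_M_u_Int_M_v[OF u v])
  thus "forms_killing M u \<inter> forms_killing M v = forms.span {f}" ..
qed

lemma M_u_Int_M_v_generator:
  assumes "u \<noteq> 0" "v \<notin> span {u}"
  obtains f where "f \<in> M" "f \<noteq> 0" "forms_killing M u \<inter> forms_killing M v = forms.span {f}"
    "form_rad f = span {u, v}"
proof -
  have "\<not> forms_killing M u \<inter> forms_killing M v \<subseteq> {0}"
  proof
    assume "forms_killing M u \<inter> forms_killing M v \<subseteq> {0}"
    hence "card (forms_killing M u \<inter> forms_killing M v) \<le> card {0 :: 'b \<Rightarrow> 'b \<Rightarrow> 'a}"
      by (intro card_mono) auto
    thus False
      using card_M_u_Int_M_v[OF assms] card_UNIV_field_ge2[where ?'a = 'a] by simp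
  qed
  then obtain f where f: "f \<in> forms_killing M u \<inter> forms_killing M v" "f \<noteq> 0" by blast
  moreover have "f \<in> M" using f by (simp add: forms_killing_def)
  ultimately show thesis using that M_u_Int_M_v_eq_span[OF assms f] by blast
qed

text \<open>For weights that ignore non-degenerate forms, only the two counts of interest remain.\<close>

lemma sum_over_radicals:
  assumes "w 1 = (0 :: real)"
  shows "(\<Sum>f\<in>M - {0}. w (card (form_rad f))) =
    real (card {f \<in> M - {0}. card (form_rad f) = CARD('a)}) * w CARD('a) +
    real (card {f \<in> M - {0}. card (form_rad f) = CARD('a) ^ 2}) * w (CARD('a) ^ 2)"
proof -
  have q: "CARD('a) \<noteq> 1" "CARD('a) ^ 2 \<noteq> 1" "CARD('a) ^ 2 \<noteq> CARD('a)"
    using card_UNIV_field_ge2[where ?'a = 'a] card_field_less_square[where ?'a = 'a] by linarith+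
  have "(\<Sum>f\<in>M - {0}. w (card (form_rad f))) =
      (\<Sum>f\<in>M - {0}. (if card (form_rad f) = CARD('a) then w CARD('a) else 0) +
        (if card (form_rad f) = CARD('a) ^ 2 then w (CARD('a) ^ 2) else 0))"
  proof (rule sum.cong[OF refl])
    fix f assume "f \<in> M - {0}"
    hence "card (form_rad f) \<in> {1, CARD('a), CARD('a) ^ 2}" using card_rad by blast
    thus "w (card (form_rad f)) = (if card (form_rad f) = CARD('a) then w CARD('a) else 0) +
        (if card (form_rad f) = CARD('a) ^ 2 then w (CARD('a) ^ 2) else 0)"
      using assms q by auto
  qed
  thus ?thesis by (simp only: sum.distrib sum_if_const_card finite_forms) simp
qed

text \<open>Every independent pair lies in the radical of exactly \<open>q - 1\<close> non-zero members of \<open>M\<close>, which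
  counts the radicals of size \<open>q\<^sup>2\<close>; every non-zero vector lies in exactly \<open>B - 1\<close> of them, which
  then gives those of size \<open>q\<close>.\<close>

lemma card_rad_counts:
  shows "real (card {f \<in> M - {0}. card (form_rad f) = CARD('a) ^ 2}) *
      (real CARD('a) ^ 2 - 1) = (real CARD('a) ^ n - 1) * (real CARD('a) ^ (n - 1) - 1)"
    and "real (card {f \<in> M - {0}. card (form_rad f) = CARD('a)}) =
      real CARD('a) ^ (n - 1) * (real CARD('a) ^ n - 1)"
proof -
  let ?q = "real CARD('a)" and ?B = "real CARD('b)"
  let ?a1 = "real (card {f \<in> M - {0}. card (form_rad f) = CARD('a)})"
  let ?a2 = "real (card {f \<in> M - {0}. card (form_rad f) = CARD('a) ^ 2})"
  have q: "?q \<ge> 2" by (rule CARD_ge2)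
  have B: "?B = ?q ^ n" unfolding card_V by simp
  have Bq: "?B = ?q * ?q ^ (n - 1)" unfolding B using n by (simp flip: power_Suc)
  have symm: "f \<in> symm_forms scale" if "f \<in> M" for f using that M by blast
  have M0: "0 \<in> M" by (rule forms.subspace_0[OF M(1)])
  have card_diff: "real (card (S - {0})) = real (card S) - 1"
    if "0 \<in> S" "finite S" for S :: "'c::zero set"
  proof -
    have "card S > 0" using that by (auto simp: card_gt_0_iff)
    thus ?thesis using that by (simp add: card_Diff_singleton of_nat_diff)
  qed

  let ?P = "{p. fst p \<noteq> 0 \<and> snd p \<notin> span {fst p}}"
  have "(\<Sum>p\<in>?P. real (card {f \<in> M - {0}. fst p \<in> form_rad f \<and> snd p \<in> form_rad f})) =
      (\<Sum>f\<in>M - {0}. real (card {p \<in> ?P. fst p \<in> form_rad f \<and> snd p \<in> form_rad f}))"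
    by (rule sum_card_swap) auto
  also have "\<dots> = (\<Sum>f\<in>M - {0}. (real (card (form_rad f)) - 1) * (real (card (form_rad f)) - ?q))"
  proof (rule sum.cong[OF refl])
    fix f assume "f \<in> M - {0}"
    hence "subspace (form_rad f)" using symm subspace_form_rad by blast
    from card_independent_pairs[OF this]
    show "real (card {p \<in> ?P. fst p \<in> form_rad f \<and> snd p \<in> form_rad f}) =
        (real (card (form_rad f)) - 1) * (real (card (form_rad f)) - ?q)"
      by (simp add: conj_assoc)
  qed
  also have "\<dots> = ?a2 * ((?q ^ 2 - 1) * (?q ^ 2 - ?q))"
    by (subst sum_over_radicals[of "\<lambda>r. (real r - 1) * (real r - ?q)"]) simp_all
  finally have pairs: "(\<Sum>p\<in>?P. real (card {f \<in> M - {0}. fst p \<in> form_rad f \<and> snd p \<in> form_rad f})) =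
      ?a2 * ((?q ^ 2 - 1) * (?q ^ 2 - ?q))" .
  have "real (card {f \<in> M - {0}. fst p \<in> form_rad f \<and> snd p \<in> form_rad f}) = ?q - 1"
    if p: "p \<in> ?P" for p
  proof -
    let ?I = "forms_killing M (fst p) \<inter> forms_killing M (snd p)"
    have "{f \<in> M - {0}. fst p \<in> form_rad f \<and> snd p \<in> form_rad f} = ?I - {0}"
      by (auto simp: forms_killing_def)
    moreover have "0 \<in> ?I" using M0 by (simp add: forms_killing_def form_rad_def)
    moreover have "card ?I = CARD('a)" using p by (intro card_M_u_Int_M_v) auto
    ultimately show ?thesis using card_diff[of ?I] by simp
  qed
  hence "(\<Sum>p\<in>?P. real (card {f \<in> M - {0}. fst p \<in> form_rad f \<and> snd p \<in> form_rad f})) =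
      (\<Sum>p\<in>?P. ?q - 1)" by (rule sum.cong[OF refl])
  also have "\<dots> = (?B - 1) * (?B - ?q) * (?q - 1)"
    using card_independent_pairs[OF subspace_UNIV] by simp
  finally have "?a2 * ((?q ^ 2 - 1) * (?q ^ 2 - ?q)) = (?B - 1) * (?B - ?q) * (?q - 1)"
    using pairs by simp
  hence "(?q * (?q - 1)) * (?a2 * (?q ^ 2 - 1)) = (?q * (?q - 1)) * ((?B - 1) * (?q ^ (n - 1) - 1))"
    unfolding Bq by (simp add: power2_eq_square algebra_simps)
  hence a2: "?a2 * (?q ^ 2 - 1) = (?B - 1) * (?q ^ (n - 1) - 1)" using q by simp
  thus "?a2 * (?q ^ 2 - 1) = (?q ^ n - 1) * (?q ^ (n - 1) - 1)" unfolding B .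

  have "(\<Sum>u\<in>UNIV - {0}. real (card {f \<in> M - {0}. u \<in> form_rad f})) =
      (\<Sum>f\<in>M - {0}. real (card {u \<in> UNIV - {0}. u \<in> form_rad f}))"
    by (rule sum_card_swap) auto
  also have "\<dots> = (\<Sum>f\<in>M - {0}. real (card (form_rad f)) - 1)"
  proof (rule sum.cong[OF refl])
    fix f assume "f \<in> M - {0}"
    hence "0 \<in> form_rad f" using symm subspace_form_rad subspace_0 by blast
    moreover have "{u \<in> UNIV - {0}. u \<in> form_rad f} = form_rad f - {0}" by auto
    ultimately show "real (card {u \<in> UNIV - {0}. u \<in> form_rad f}) = real (card (form_rad f)) - 1"
      using card_diff[of "form_rad f"] by simp
  qed
  also have "\<dots> = ?a1 * (?q - 1) + ?a2 * (?q ^ 2 - 1)"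
    by (subst sum_over_radicals[of "\<lambda>r. real r - 1"]) simp_all
  finally have singles: "(\<Sum>u\<in>UNIV - {0}. real (card {f \<in> M - {0}. u \<in> form_rad f})) =
      ?a1 * (?q - 1) + ?a2 * (?q ^ 2 - 1)" .
  have "real (card {f \<in> M - {0}. u \<in> form_rad f}) = ?B - 1" if "u \<in> UNIV - {0}" for u
  proof -
    have "{f \<in> M - {0}. u \<in> form_rad f} = forms_killing M u - {0}"
      by (auto simp: forms_killing_def)
    moreover have "0 \<in> forms_killing M u" using M0 by (simp add: forms_killing_def form_rad_def)
    ultimately show ?thesis using card_diff[of "forms_killing M u"] card_M_u(1)[of u] that by simp
  qed
  hence "(\<Sum>u\<in>UNIV - {0}. real (card {f \<in> M - {0}. u \<in> form_rad f})) =
      (\<Sum>u\<in>UNIV - {0 :: 'b}. ?B - 1)" by (rule sum.cong[OF refl])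
  also have "\<dots> = (?B - 1) * (?B - 1)" using card_diff[of "UNIV :: 'b set"] by simp
  finally have "?a1 * (?q - 1) = (?B - 1) * (?B - 1) - (?B - 1) * (?q ^ (n - 1) - 1)"
    using singles a2 by simp
  also have "\<dots> = (?q ^ (n - 1) * (?B - 1)) * (?q - 1)"
    using Bq by (simp add: algebra_simps)
  finally show "?a1 = ?q ^ (n - 1) * (?q ^ n - 1)" using q unfolding B by simp
qed

end

section \<open>The correspondence with planes\<close>

text \<open>On a line of forms this is the radical of any generator, so it describes the correspondence
  without choosing one.\<close>

definition common_radical :: "('v \<Rightarrow> 'v \<Rightarrow> 'a::zero) set \<Rightarrow> 'v set" where
  "common_radical L = {x. \<forall>f\<in>L. x \<in> form_rad f}"

lemma common_radical_span:
  "common_radical (forms.span {f}) = form_rad (f :: 'v \<Rightarrow> 'v \<Rightarrow> 'a::{field,finite})"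
proof
  show "common_radical (forms.span {f}) \<subseteq> form_rad f"
    using forms.span_base[of f "{f}"] by (auto simp: common_radical_def)
  show "form_rad f \<subseteq> common_radical (forms.span {f})"
    unfolding forms.span_singleton by (auto simp: common_radical_def form_rad_def form_scale_def)
qed

context extremal_forms
begin

lemma dim_V: "dim UNIV = n"
  by (rule dim_eqI_card[OF subspace_UNIV finite_V]) (simp add: card_V)

text \<open>The bound on \<open>j\<close> keeps \<open>n - j\<close> positive, which excludes the zero form.\<close>

lemma form_rank_eq_iff:
  assumes f: "f \<in> M" and j: "j \<le> 2"
  shows "form_rank scale f = n - j \<longleftrightarrow> f \<noteq> 0 \<and> card (form_rad f) = CARD('a) ^ j"
proof -
  have q: "CARD('a) > 1" using card_UNIV_field_ge2[where ?'a = 'a] by simp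
  have "f \<in> symm_forms scale" using f M by blast
  from card_subspace[OF subspace_form_rad[OF this]]
  have card: "card (form_rad f) = CARD('a) ^ dim (form_rad f)"
    by (simp flip: of_nat_power)
  moreover have "card (form_rad f) \<le> CARD('b)" by (rule card_mono) auto
  ultimately have le: "dim (form_rad f) \<le> n" using q by (simp add: card_V)
  have "form_rank scale f = n - j \<longleftrightarrow> dim (form_rad f) = j"
    unfolding form_rank_def dim_V using le j n by auto
  moreover have "dim (form_rad f) = n" if "f = 0"
  proof -
    have "form_rad f = UNIV" using that by (auto simp: form_rad_def)
    thus ?thesis by (simp add: dim_V)
  qed
  ultimately show ?thesis using card q j n by auto
qed

lemma num_rank_eq:
  assumes "j \<le> 2"
  shows "num_rank scale M (n - j) = card {f \<in> M - {0}. card (form_rad f) = CARD('a) ^ j}"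
  unfolding num_rank_def
  by (rule arg_cong[of _ _ card]) (use form_rank_eq_iff[OF _ assms] in blast)

lemma forms_killing_subspaces_of_dim:
  assumes "u \<noteq> 0"
  shows "forms_killing M u \<in> subspaces_of_dim form_scale n"
proof -
  have sub: "forms.subspace (forms_killing M u)" by (rule subspace_forms_killing[OF M(1)])
  moreover have "forms.dim (forms_killing M u) = n"
    by (rule forms.dim_eqI_card[OF sub]) (simp_all add: card_M_u(1)[OF assms] card_V)
  ultimately show ?thesis by (simp add: subspaces_of_dim_def)
qed

lemma plane_card_iff: "W \<in> subspaces_of_dim scale 2 \<longleftrightarrow> subspace W \<and> card W = CARD('a) ^ 2"
proof
  assume "W \<in> subspaces_of_dim scale 2"
  hence "subspace W" "dim W = 2" by (auto simp: subspaces_of_dim_def)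
  with card_subspace[of W] show "subspace W \<and> card W = CARD('a) ^ 2"
    by (simp flip: of_nat_power)
next
  assume W: "subspace W \<and> card W = CARD('a) ^ 2"
  hence "dim W = 2" by (intro dim_eqI_card) auto
  with W show "W \<in> subspaces_of_dim scale 2" by (simp add: subspaces_of_dim_def)
qed

lemma M_u_Int_M_v_rank_line:
  assumes uv: "u \<noteq> 0" "v \<notin> span {u}"
  defines "L \<equiv> forms_killing M u \<inter> forms_killing M v"
  shows "L \<in> subspaces_of_dim form_scale 1" "L \<in> rank_lines scale M (n - 2)"
    "common_radical L = span {u, v}"
proof -
  obtain f where f: "f \<in> M" "f \<noteq> 0" "L = forms.span {f}" "form_rad f = span {u, v}"
    unfolding L_def by (rule M_u_Int_M_v_generator[OF uv])
  have sub: "forms.subspace L" unfolding f(3) by (rule forms.subspace_span)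
  have "forms.dim L = 1"
    by (rule forms.dim_eqI_card[OF sub]) (simp_all add: L_def card_M_u_Int_M_v[OF uv])
  with sub show dim: "L \<in> subspaces_of_dim form_scale 1" by (simp add: subspaces_of_dim_def)
  have "card (form_rad f) = CARD('a) ^ 2" unfolding f(4) by (rule card_span_pair[OF uv])
  hence "form_rank scale f = n - 2" using form_rank_eq_iff[OF f(1), of 2] f(2) by simp
  moreover have "L \<subseteq> M" by (auto simp: L_def forms_killing_def)
  ultimately show "L \<in> rank_lines scale M (n - 2)"
    unfolding rank_lines_def using dim f by blast
  show "common_radical L = span {u, v}" unfolding f(3) common_radical_span f(4) ..
qed

lemma rank_line_cases:
  assumes "L \<in> rank_lines scale M (n - 2)"
  obtains u v where "u \<noteq> 0" "v \<notin> span {u}" "L = forms_killing M u \<inter> forms_killing M v"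
proof -
  obtain f where f: "f \<in> M" "form_rank scale f = n - 2" "L = forms.span {f}"
    using assms by (auto simp: rank_lines_def)
  hence f0: "f \<noteq> 0" and card: "card (form_rad f) = CARD('a) ^ 2"
    using form_rank_eq_iff[OF f(1), of 2] by auto
  have "subspace (form_rad f)" using f M subspace_form_rad by blast
  then obtain u v where uv: "u \<noteq> 0" "v \<notin> span {u}" "form_rad f = span {u, v}"
    using subspace_card_sq_basis[OF _ card] by blast
  have "f \<in> forms_killing M u \<inter> forms_killing M v"
    using f(1) uv(3) span_base[of _ "{u, v}"] by (auto simp: forms_killing_def)
  from M_u_Int_M_v_eq_span(2)[OF uv(1,2) this f0] f(3) uv that show thesis by metis
qed

text \<open>The intersection depends only on the plane spanned by \<open>u\<close> and \<open>v\<close>; this makes the correspondence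
  injective.\<close>

lemma M_u_Int_M_v_conv_span:
  "forms_killing M u \<inter> forms_killing M v = {f \<in> M. span {u, v} \<subseteq> form_rad f}"
proof -
  have "u \<in> form_rad f \<and> v \<in> form_rad f \<longleftrightarrow> span {u, v} \<subseteq> form_rad f" if "f \<in> M" for f
  proof
    have "f \<in> symm_forms scale" using that M by blast
    thus "span {u, v} \<subseteq> form_rad f" if "u \<in> form_rad f \<and> v \<in> form_rad f"
      using that by (intro span_minimal subspace_form_rad) auto
    show "u \<in> form_rad f \<and> v \<in> form_rad f" if "span {u, v} \<subseteq> form_rad f"
      using that span_base[of _ "{u, v}"] by auto
  qed
  thus ?thesis by (auto simp only: forms_killing_def)
qed

lemma bij_betw_common_radical:
  "bij_betw common_radical (rank_lines scale M (n - 2)) (subspaces_of_dim scale 2)"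
proof (rule bij_betw_imageI)
  show "inj_on common_radical (rank_lines scale M (n - 2))"
  proof (rule inj_onI)
    fix L L' assume L: "L \<in> rank_lines scale M (n - 2)" "L' \<in> rank_lines scale M (n - 2)"
      and eq: "common_radical L = common_radical L'"
    obtain u v where uv: "u \<noteq> 0" "v \<notin> span {u}" "L = forms_killing M u \<inter> forms_killing M v"
      by (rule rank_line_cases[OF L(1)])
    obtain u' v' where uv': "u' \<noteq> 0" "v' \<notin> span {u'}" "L' = forms_killing M u' \<inter> forms_killing M v'"
      by (rule rank_line_cases[OF L(2)])
    have "span {u, v} = span {u', v'}"
      using eq unfolding uv(3) uv'(3) M_u_Int_M_v_rank_line(3)[OF uv(1,2)]
        M_u_Int_M_v_rank_line(3)[OF uv'(1,2)] .
    thus "L = L'" unfolding uv(3) uv'(3) M_u_Int_M_v_conv_span by simp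
  qed
  show "common_radical ` rank_lines scale M (n - 2) = subspaces_of_dim scale 2"
  proof
    show "common_radical ` rank_lines scale M (n - 2) \<subseteq> subspaces_of_dim scale 2"
    proof
      fix W assume "W \<in> common_radical ` rank_lines scale M (n - 2)"
      then obtain L where L: "L \<in> rank_lines scale M (n - 2)" "W = common_radical L" by blast
      obtain u v where uv: "u \<noteq> 0" "v \<notin> span {u}" "L = forms_killing M u \<inter> forms_killing M v"
        by (rule rank_line_cases[OF L(1)])
      have "W = span {u, v}" unfolding L(2) uv(3) by (rule M_u_Int_M_v_rank_line(3)[OF uv(1,2)])
      thus "W \<in> subspaces_of_dim scale 2"
        unfolding plane_card_iff using card_span_pair[OF uv(1,2)] by simp
    qed
    show "subspaces_of_dim scale 2 \<subseteq> common_radical ` rank_lines scale M (n - 2)"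
    proof
      fix W assume "W \<in> subspaces_of_dim scale 2"
      then obtain u v where uv: "u \<noteq> 0" "v \<notin> span {u}" "W = span {u, v}"
        unfolding plane_card_iff using subspace_card_sq_basis by blast
      show "W \<in> common_radical ` rank_lines scale M (n - 2)"
        using M_u_Int_M_v_rank_line(2,3)[OF uv(1,2)] uv(3) by blast
    qed
  qed
qed

end

theorem theorem18:
  fixes scale :: "'a::{field,finite} \<Rightarrow> 'v::ab_group_add \<Rightarrow> 'v"
    and M :: "('v \<Rightarrow> 'v \<Rightarrow> 'a) set"
    and n q :: nat
  assumes "card (UNIV :: 'a set) = q"
    and "n \<ge> 3" and "odd n"
    and "vector_space scale" and "vector_space.dim scale (UNIV :: 'v set) = n"
    and "module.subspace form_scale M" and "M \<subseteq> symm_forms scale"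
    and "vector_space.dim form_scale M = 2 * n"
    and "\<forall>f\<in>M. f \<noteq> 0 \<longrightarrow> form_rank scale f \<ge> n - 2"
  shows "real (num_rank scale M (n - 1)) = real q ^ (n - 1) * (real q ^ n - 1) \<and>
    real (num_rank scale M (n - 2)) =
      (real q ^ n - 1) * (real q ^ (n - 1) - 1) / (real q ^ 2 - 1) \<and>
    (\<forall>u. u \<noteq> 0 \<longrightarrow> forms_killing M u \<in> subspaces_of_dim form_scale n) \<and>
    (\<exists>\<Phi>. bij_betw \<Phi> (rank_lines scale M (n - 2)) (subspaces_of_dim scale 2) \<and>
      (\<forall>f\<in>M. form_rank scale f = n - 2 \<longrightarrow> \<Phi> (module.span form_scale {f}) = form_rad f) \<and>
      (\<forall>u v. u \<noteq> 0 \<longrightarrow> v \<notin> module.span scale {u} \<longrightarrow>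
        forms_killing M u \<inter> forms_killing M v \<in> subspaces_of_dim form_scale 1 \<and>
        forms_killing M u \<inter> forms_killing M v \<in> rank_lines scale M (n - 2) \<and>
        \<Phi> (forms_killing M u \<inter> forms_killing M v) = module.span scale {u, v}))"
proof -
  interpret finite_field_space scale by (rule finite_field_space.intro[OF assms(4)])
  have "finite (UNIV :: 'v set)"
    using assms(2,5) by (intro finite_subspace_if_dim_pos subspace_UNIV) simp
  then interpret finite_space scale by unfold_locales
  have card_V: "CARD('v) = CARD('a) ^ n"
    using card_subspace[OF subspace_UNIV finite_V] unfolding assms(5) by (simp flip: of_nat_power)
  have "card M = CARD('a) ^ (2 * n)"
    using forms.card_subspace[OF assms(6) finite_forms] unfolding assms(8)
    by (simp only: of_nat_power[symmetric] of_nat_eq_iff)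
  hence card_M: "card M = CARD('v) ^ 2"
    unfolding card_V by (simp add: power_mult[symmetric] mult.commute)
  have card_rad: "card (form_rad f) \<in> {1, CARD('a), CARD('a) ^ 2}" if f: "f \<in> M" "f \<noteq> 0" for f
  proof -
    have "n - 2 \<le> n - dim (form_rad f)" using assms(9) f unfolding form_rank_def assms(5) by blast
    hence "dim (form_rad f) \<le> 2" using assms(2) by linarith
    hence "dim (form_rad f) \<in> {0, 1, 2}" by auto
    moreover have "f \<in> symm_forms scale" using f assms(7) by blast
    from card_subspace[OF subspace_form_rad[OF this]]
    have "card (form_rad f) = CARD('a) ^ dim (form_rad f)" by (simp flip: of_nat_power)
    ultimately show ?thesis by auto
  qed
  interpret extremal_forms scale M n
    by unfold_locales (fact assms(2,3,6,7) card_V card_M card_rad)+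
  have "real q \<ge> 2" using CARD_ge2 unfolding assms(1) .
  hence "real q ^ 2 \<ge> 2 ^ 2" by (intro power_mono) simp_all
  hence nz: "real q ^ 2 - 1 \<noteq> 0" by simp
  have "real (num_rank scale M (n - 2)) * (real q ^ 2 - 1) =
      (real q ^ n - 1) * (real q ^ (n - 1) - 1)"
    unfolding num_rank_eq[OF order_refl] assms(1)[symmetric] by (rule card_rad_counts(1))
  hence corank2: "real (num_rank scale M (n - 2)) =
      (real q ^ n - 1) * (real q ^ (n - 1) - 1) / (real q ^ 2 - 1)"
    using nz by (simp only: eq_divide_eq) simp
  have corank1: "real (num_rank scale M (n - 1)) = real q ^ (n - 1) * (real q ^ n - 1)"
    unfolding num_rank_eq[OF one_le_numeral] power_one_right assms(1)[symmetric]
    by (rule card_rad_counts(2))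
  show ?thesis
  proof (intro conjI exI[of _ common_radical] allI impI ballI)
    show "common_radical (forms.span {f}) = form_rad f" for f
      by (rule common_radical_span)
  qed (fact corank1 corank2 forms_killing_subspaces_of_dim bij_betw_common_radical
      M_u_Int_M_v_rank_line)+
qed

end
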